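(* Let $p,q\in\mathbb{F}[t]$ be monic polynomials of degree $2$, set $\delta:=\operatorname{tr}p-\operatorname{tr}q$, and assume that $p$ is split over $\mathbb{F}$ with simple roots and that $q$ is split over $\mathbb{F}$ with a double root. Let $v$ be a $(p,q)$-exceptional endomorphism of a vector space $V$ over $\mathbb{F}$. The following conditions are equivalent: (i) $S(v)$ is a symplectic $(p,q)$-difference; (ii) $h(v)$ is a $(p,q)$-difference in $\operatorname{End}(V\times V^\star)$; (iii) $v$ is a $(p,q)$-difference in $\operatorname{End}(V)$; (iv) writing $\operatorname{Root}(p)-\operatorname{Root}(q)=\{x,\delta-x\}$, the sequences $(n_k(v,x))_{k\geq1}$ and $(n_k(v,\delta-x))_{k\geq1}$ are $2$-intertwined.
   Context: $\mathbb{F}$ is an arbitrary field (characteristic $2$ allowed), with a fixed algebraic closure $\overline{\mathbb{F}}$; all vector spaces are finite-dimensional over $\mathbb{F}$. For a monic polynomial $r\in\mathbb{F}[t]$ of degree $n>0$, $\operatorname{tr}r$ is the opposite of the coefficient of $r$ on $t^{n-1}$, and $\operatorname{Root}(r)$ is the set of roots of $r$ in $\overline{\mathbb{F}}$; $\operatorname{Root}(p)-\operatorname{Root}(q):=\{x-y : x\in\operatorname{Root}(p),\,y\in\operatorname{Root}(q)\}$. An endomorphism is $(p,q)$-exceptional if all its eigenvalues in $\overline{\mathbb{F}}$ belong to $\operatorname{Root}(p)-\operatorname{Root}(q)$. An element $a$ of an $\mathbb{F}$-algebra $\mathcal{A}$ is a $(p,q)$-difference in $\mathcal{A}$ if $a=a_1-a_2$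 for some $a_1,a_2\in\mathcal{A}$ with $p(a_1)=0=q(a_2)$. For an endomorphism $u$ of $V$, $\lambda\in\mathbb{F}$ and $k\ge1$, $n_k(u,\lambda):=\dim\operatorname{Ker}(u-\lambda\operatorname{id}_V)^k-\dim\operatorname{Ker}(u-\lambda\operatorname{id}_V)^{k-1}$. For a positive integer $m$, two non-increasing sequences $(a_n)_{n\ge1}$, $(b_n)_{n\ge1}$ of non-negative integers are $m$-intertwined if $a_{n+m}\le b_n$ and $b_{n+m}\le a_n$ for all $n\ge1$. A symplectic form is a non-degenerate alternating bilinear form. Given a symplectic form $b$ on $V$, an endomorphism $u$ of $V$ is $b$-alternating if $b(x,u(x))=0$ for all $x\in V$. A symplectic pair $(b,u)$ consists of a symplectic form $b$ on a vector space and a $b$-alternating endomorphism $u$ of it. It is a symplectic $(p,q)$-difference if there are $b$-alternating endomorphisms $u_1,u_2$ with $u=u_1-u_2$, $p(u_1)=0$ and $q(u_2)=0$. For an endomorphism $v$ of $V$ with transpose $v^t:\varphi\mapsto\varphi\circ v$ on the dual space $V^\star$, put $h(v):=v\oplus v^t$ on $V\times V^\star$ and $S_V((x,\varphi),(y,\psi)):=\varphi(y)-\psi(x)$. The symplectic extension of $v$ is the symplectic pair $S(v):=(S_V,h(v))$. *)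

theory Defs
  imports
    "HOL-Algebra.Algebraic_Closure_Type"
    "HOL-Library.Function_Algebras"
    "HOL-Library.Product_Plus"
    "Jordan_Normal_Form.Char_Poly"
begin

section \<open>Polynomials\<close>

definition poly_tr :: "'a::field poly \<Rightarrow> 'a" where
  "poly_tr r = - coeff r (degree r - 1)"

text \<open>The fixed algebraic closure is the type \<open>'a alg_closure\<close>, with embedding \<^const>\<open>to_ac\<close>.\<close>

definition Root :: "'a::field poly \<Rightarrow> 'a alg_closure set" where
  "Root r = {x. poly (map_poly to_ac r) x = 0}"

definition Root_diff :: "'a::field poly \<Rightarrow> 'a poly \<Rightarrow> 'a alg_closure set" where
  "Root_diff p q = {x - y | x y. x \<in> Root p \<and> y \<in> Root q}"

definition split_poly :: "'a::field poly \<Rightarrow> bool" where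
  "split_poly r \<longleftrightarrow> r \<noteq> 0 \<and> (\<exists>A. r = smult (lead_coeff r) (\<Prod>a\<in>#A. [:- a, 1:]))"

definition split_simple_roots :: "'a::field poly \<Rightarrow> bool" where
  "split_simple_roots r \<longleftrightarrow> split_poly r \<and> (\<forall>a. poly r a = 0 \<longrightarrow> order a r = 1)"

definition split_double_root :: "'a::field poly \<Rightarrow> bool" where
  "split_double_root r \<longleftrightarrow> split_poly r \<and> (\<exists>a. order a r = 2)"


section \<open>Endomorphisms\<close>

text \<open>
  A vector space is a subspace \<open>W\<close> of an ambient space with scalar multiplication \<open>s\<close>. The carrier
  is needed because the dual space consists of the linear functions among all functions.
  An element of \<open>End(W)\<close> is represented by any function whose restriction to \<open>W\<close> is that
  endomorphism, so equations between endomorphisms are required on \<open>W\<close> only.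
\<close>

definition linear_on ::
  "('a::field \<Rightarrow> 'w::ab_group_add \<Rightarrow> 'w) \<Rightarrow> ('a \<Rightarrow> 'z::ab_group_add \<Rightarrow> 'z) \<Rightarrow> 'w set \<Rightarrow> ('w \<Rightarrow> 'z) \<Rightarrow> bool" where
  "linear_on s s' W f \<longleftrightarrow>
     (\<forall>x\<in>W. \<forall>y\<in>W. f (x + y) = f x + f y) \<and> (\<forall>c. \<forall>x\<in>W. f (s c x) = s' c (f x))"

definition endo_on :: "('a::field \<Rightarrow> 'w::ab_group_add \<Rightarrow> 'w) \<Rightarrow> 'w set \<Rightarrow> ('w \<Rightarrow> 'w) \<Rightarrow> bool" where
  "endo_on s W f \<longleftrightarrow> f ` W \<subseteq> W \<and> linear_on s s W f"

definition poly_endo ::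
  "('a::field \<Rightarrow> 'w::ab_group_add \<Rightarrow> 'w) \<Rightarrow> 'a poly \<Rightarrow> ('w \<Rightarrow> 'w) \<Rightarrow> 'w \<Rightarrow> 'w" where
  "poly_endo s r f x = (\<Sum>i\<le>degree r. s (coeff r i) ((f ^^ i) x))"

definition pq_difference ::
  "('a::field \<Rightarrow> 'w::ab_group_add \<Rightarrow> 'w) \<Rightarrow> 'w set \<Rightarrow> 'a poly \<Rightarrow> 'a poly \<Rightarrow> ('w \<Rightarrow> 'w) \<Rightarrow> bool" where
  "pq_difference s W p q u \<longleftrightarrow>
     (\<exists>u\<^sub>1 u\<^sub>2. endo_on s W u\<^sub>1 \<and> endo_on s W u\<^sub>2 \<and> (\<forall>x\<in>W. u x = u\<^sub>1 x - u\<^sub>2 x) \<and>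
        (\<forall>x\<in>W. poly_endo s p u\<^sub>1 x = 0) \<and> (\<forall>x\<in>W. poly_endo s q u\<^sub>2 x = 0))"

text \<open>
  Eigenvalues in the algebraic closure are those of the matrix of the endomorphism in an ordered
  basis, regarded as a matrix over the closure; the choice of basis does not matter.
\<close>

definition ordered_basis :: "('a::field \<Rightarrow> 'v::ab_group_add \<Rightarrow> 'v) \<Rightarrow> 'v list \<Rightarrow> bool" where
  "ordered_basis s bs \<longleftrightarrow>
     distinct bs \<and> \<not> module.dependent s (set bs) \<and> module.span s (set bs) = UNIV"

definition endo_mat :: "('a::field \<Rightarrow> 'v::ab_group_add \<Rightarrow> 'v) \<Rightarrow> 'v list \<Rightarrow> ('v \<Rightarrow> 'v) \<Rightarrow> 'a mat" where
  "endo_mat s bs u = mat (length bs) (length bs)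
     (\<lambda>(i, j). module.representation s (set bs) (u (bs ! j)) (bs ! i))"

definition ac_eigenvalue ::
  "('a::field \<Rightarrow> 'v::ab_group_add \<Rightarrow> 'v) \<Rightarrow> ('v \<Rightarrow> 'v) \<Rightarrow> 'a alg_closure \<Rightarrow> bool" where
  "ac_eigenvalue s u \<mu> \<longleftrightarrow>
     (\<exists>bs. ordered_basis s bs \<and> eigenvalue (map_mat to_ac (endo_mat s bs u)) \<mu>)"

definition pq_exceptional ::
  "('a::field \<Rightarrow> 'v::ab_group_add \<Rightarrow> 'v) \<Rightarrow> 'a poly \<Rightarrow> 'a poly \<Rightarrow> ('v \<Rightarrow> 'v) \<Rightarrow> bool" where
  "pq_exceptional s p q u \<longleftrightarrow> (\<forall>\<mu>. ac_eigenvalue s u \<mu> \<longrightarrow> \<mu> \<in> Root_diff p q)"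

definition ker_pow :: "('a::field \<Rightarrow> 'v::ab_group_add \<Rightarrow> 'v) \<Rightarrow> ('v \<Rightarrow> 'v) \<Rightarrow> 'a \<Rightarrow> nat \<Rightarrow> 'v set" where
  "ker_pow s u \<mu> k = {x. ((\<lambda>y. u y - s \<mu> y) ^^ k) x = 0}"

text \<open>The kernels increase with \<open>k\<close>, so the subtraction of natural numbers is not truncated.\<close>

definition jordan_count ::
  "('a::field \<Rightarrow> 'v::ab_group_add \<Rightarrow> 'v) \<Rightarrow> ('v \<Rightarrow> 'v) \<Rightarrow> 'a \<Rightarrow> nat \<Rightarrow> nat" where
  "jordan_count s u \<mu> k =
     vector_space.dim s (ker_pow s u \<mu> k) - vector_space.dim s (ker_pow s u \<mu> (k - 1))"

text \<open>Sequences are indexed from 1; their values at 0 are irrelevant.\<close>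

definition intertwined :: "nat \<Rightarrow> (nat \<Rightarrow> nat) \<Rightarrow> (nat \<Rightarrow> nat) \<Rightarrow> bool" where
  "intertwined m a b \<longleftrightarrow> (\<forall>n\<ge>1. a (n + m) \<le> b n \<and> b (n + m) \<le> a n)"


section \<open>Symplectic pairs\<close>

definition symplectic_form ::
  "('a::field \<Rightarrow> 'w::ab_group_add \<Rightarrow> 'w) \<Rightarrow> 'w set \<Rightarrow> ('w \<Rightarrow> 'w \<Rightarrow> 'a) \<Rightarrow> bool" where
  "symplectic_form s W b \<longleftrightarrow>
     (\<forall>y\<in>W. linear_on s (*) W (\<lambda>x. b x y)) \<and> (\<forall>x\<in>W. linear_on s (*) W (\<lambda>y. b x y)) \<and>
     (\<forall>x\<in>W. b x x = 0) \<and>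
     (\<forall>x\<in>W. (\<forall>y\<in>W. b x y = 0) \<longrightarrow> x = 0)"

definition alternating_endo ::
  "('a::field \<Rightarrow> 'w::ab_group_add \<Rightarrow> 'w) \<Rightarrow> 'w set \<Rightarrow> ('w \<Rightarrow> 'w \<Rightarrow> 'a) \<Rightarrow> ('w \<Rightarrow> 'w) \<Rightarrow> bool" where
  "alternating_endo s W b u \<longleftrightarrow> endo_on s W u \<and> (\<forall>x\<in>W. b x (u x) = 0)"

definition symplectic_pair ::
  "('a::field \<Rightarrow> 'w::ab_group_add \<Rightarrow> 'w) \<Rightarrow> 'w set \<Rightarrow> ('w \<Rightarrow> 'w \<Rightarrow> 'a) \<times> ('w \<Rightarrow> 'w) \<Rightarrow> bool" where
  "symplectic_pair s W = (\<lambda>(b, u). symplectic_form s W b \<and> alternating_endo s W b u)"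

definition symplectic_pq_difference ::
  "('a::field \<Rightarrow> 'w::ab_group_add \<Rightarrow> 'w) \<Rightarrow> 'w set \<Rightarrow> 'a poly \<Rightarrow> 'a poly \<Rightarrow>
     ('w \<Rightarrow> 'w \<Rightarrow> 'a) \<times> ('w \<Rightarrow> 'w) \<Rightarrow> bool" where
  "symplectic_pq_difference s W p q = (\<lambda>(b, u). symplectic_pair s W (b, u) \<and>
     (\<exists>u\<^sub>1 u\<^sub>2. alternating_endo s W b u\<^sub>1 \<and> alternating_endo s W b u\<^sub>2 \<and>
        (\<forall>x\<in>W. u x = u\<^sub>1 x - u\<^sub>2 x) \<and>
        (\<forall>x\<in>W. poly_endo s p u\<^sub>1 x = 0) \<and> (\<forall>x\<in>W. poly_endo s q u\<^sub>2 x = 0)))"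


section \<open>The symplectic extension\<close>

definition dual_space :: "('a::field \<Rightarrow> 'v::ab_group_add \<Rightarrow> 'v) \<Rightarrow> ('v \<Rightarrow> 'a) set" where
  "dual_space s = {\<phi>. Vector_Spaces.linear s (*) \<phi>}"

definition ext_scale ::
  "('a::field \<Rightarrow> 'v::ab_group_add \<Rightarrow> 'v) \<Rightarrow> 'a \<Rightarrow> 'v \<times> ('v \<Rightarrow> 'a) \<Rightarrow> 'v \<times> ('v \<Rightarrow> 'a)" where
  "ext_scale s c = (\<lambda>(x, \<phi>). (s c x, \<lambda>y. c * \<phi> y))"

definition ext_space :: "('a::field \<Rightarrow> 'v::ab_group_add \<Rightarrow> 'v) \<Rightarrow> ('v \<times> ('v \<Rightarrow> 'a)) set" where
  "ext_space s = UNIV \<times> dual_space s"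

definition transpose_endo :: "('v \<Rightarrow> 'v) \<Rightarrow> ('v \<Rightarrow> 'a) \<Rightarrow> ('v \<Rightarrow> 'a)" where
  "transpose_endo v \<phi> = \<phi> \<circ> v"

definition h_ext :: "('v \<Rightarrow> 'v) \<Rightarrow> 'v \<times> ('v \<Rightarrow> 'a) \<Rightarrow> 'v \<times> ('v \<Rightarrow> 'a)" where
  "h_ext v = map_prod v (transpose_endo v)"

definition S_form :: "'v \<times> ('v \<Rightarrow> 'a::field) \<Rightarrow> 'v \<times> ('v \<Rightarrow> 'a) \<Rightarrow> 'a" where
  "S_form = (\<lambda>(x, \<phi>) (y, \<psi>). \<phi> y - \<psi> x)"

definition S_ext ::
  "('v \<Rightarrow> 'v) \<Rightarrow>
     ('v \<times> ('v \<Rightarrow> 'a::field) \<Rightarrow> 'v \<times> ('v \<Rightarrow> 'a) \<Rightarrow> 'a) \<times> ('v \<times> ('v \<Rightarrow> 'a) \<Rightarrow> 'v \<times> ('v \<Rightarrow> 'a))" where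
  "S_ext v = (S_form, h_ext v)"

end

(*
  Let c be the double root of q and x, y the two elements of Root(p) - Root(q). Subtracting c from u_1 and u_2,
  u = u_1 - u_2 is a (p,q)-difference if and only if u = D - N with (D - x)(D - y) = 0 and N^2 = 0.

  Necessity. The endomorphism z = (u - x)(u - y) commutes with D and N, and its Jordan counts on Ker(D - x)
  and Ker(D - y) are those of u at x and y. The maps (D - x)N and (D - y)N go back and forth between these two
  eigenspaces and compose to z^2, so z^2 Ker(D - x) is a quotient of a submodule of Ker(D - y), and conversely.

  Sufficiency. Write V as the sum of the generalized eigenspaces of u at x and y. Pairing Jordan blocks in
  decreasing order of size gives maps back and forth which intertwine the nilpotents u - x and -(u - y) and
  compose to their squares. Rescaled by a unit and corrected by a polynomial in u they yield N.

  For h(v), the dual space is identified with V by means of a basis; then h(v) becomes the direct sum of v and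
  of an adjoint of v, so that its Jordan counts are twice those of v.
*)
theory Submission
  imports Defs "HOL-Analysis.Product_Vector"
begin

text \<open>Write a, b for the two elements x, y, as the code does, and z = (u - a) (u - b). If N^2
  = 0, the quadratic equation for D = u + N becomes linear in N: u N + N u - (a + b) N = - z. A
  solution commuting with u is - z (2 u - a - b)^-1; the inverse exists in every characteristic
  because (2 u - a - b)^2 = 4 z + (a - b)^2, where z is nilpotent by exceptionality and a, b differ.
  The correction G has to solve u G + G u = (a + b) G, which turns u - a into - (u - b) and explains
  that sign. Then G commutes with z and anticommutes with (2 u - a - b)^-1, so N^2 = 0 amounts to
  G^2 = - z^2 (2 u - a - b)^-2. On each generalized eigenspace z is a unit times the nilpotent part
  of u, so going back and forth must give a unit times the square of that part: this is where the
  number 2 comes from. Two chains admit such maps as soon as their lengths differ by at most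
  2.\<close>

section \<open>Dimensions of images and kernels\<close>

context finite_dimensional_vector_space
begin

abbreviation endo :: "('b \<Rightarrow> 'b) \<Rightarrow> bool" where
  "endo f \<equiv> Vector_Spaces.linear scale scale f"

abbreviation ker :: "('b \<Rightarrow> 'b) \<Rightarrow> 'b set" where
  "ker f \<equiv> {x. f x = 0}"

interpretation vp: finite_dimensional_vector_space_pair scale Basis scale Basis
  by unfold_locales

lemma endo_iff: "endo f \<longleftrightarrow> (\<forall>x y. f (x + y) = f x + f y) \<and> (\<forall>c x. f (scale c x) = scale c (f x))"
  using vector_space_axioms by (auto simp: Vector_Spaces.linear_iff)

lemma endoI:
  "(\<And>x y. f (x + y) = f x + f y) \<Longrightarrow> (\<And>c x. f (scale c x) = scale c (f x)) \<Longrightarrow> endo f"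
  by (simp add: endo_iff)

lemma endo_add: "endo f \<Longrightarrow> f (x + y) = f x + f y"
  and endo_scale: "endo f \<Longrightarrow> f (scale c x) = scale c (f x)"
  and endo_zero: "endo f \<Longrightarrow> f 0 = 0"
  and endo_neg: "endo f \<Longrightarrow> f (- x) = - f x"
  and endo_diff: "endo f \<Longrightarrow> f (x - y) = f x - f y"
  and endo_sum: "endo f \<Longrightarrow> f (sum h I) = (\<Sum>i\<in>I. f (h i))"
  by (fact vp.linear_add vp.linear_scale vp.linear_0 vp.linear_neg vp.linear_diff vp.linear_sum)+

lemmas endo_simps = endo_add endo_scale endo_zero endo_neg endo_diff

lemma endo_comp: "endo f \<Longrightarrow> endo g \<Longrightarrow> endo (\<lambda>x. f (g x))"
  by (simp add: endo_iff)

lemma endo_pow: "endo f \<Longrightarrow> endo (f ^^ k)"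
  by (induction k) (auto simp: endo_iff)

lemma endo_shift: "endo f \<Longrightarrow> endo (\<lambda>x. f x - scale c x)"
  by (auto simp: endo_iff algebra_simps)

lemma subspace_ker: "endo f \<Longrightarrow> subspace (ker f)"
  by (auto simp: subspace_def endo_simps)

lemma subspace_image_endo: "endo f \<Longrightarrow> subspace S \<Longrightarrow> subspace (f ` S)"
  by (fact vp.linear_subspace_image)

text \<open>The sum A + B has dimension card S + card T = card (S \<union> T) and is spanned by S
  \<union> T; a spanning set with as many elements as the dimension is independent.\<close>

lemma direct_sum_basis:
  assumes A: "subspace A" and B: "subspace B" and AB: "A \<inter> B \<subseteq> {0}"
    and S: "S \<subseteq> A" "independent S" "A \<subseteq> span S" and T: "T \<subseteq> B" "independent T" "B \<subseteq> span T"
  shows "independent (S \<union> T)" "S \<inter> T = {}"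
proof -
  have "0 \<notin> S" using S(2) dependent_zero by blast
  then show disj: "S \<inter> T = {}" using AB S(1) T(1) by blast
  let ?V = "{x + y |x y. x \<in> A \<and> y \<in> B}"
  have "dim ?V = dim A + dim B"
    using dim_sums_Int[OF A B] iffD2[OF dim_eq_0 AB] by linarith
  moreover have "dim A = card S" "dim B = card T"
    using S T by (simp_all add: basis_card_eq_dim)
  moreover have fin: "finite S" "finite T"
    using S T finiteI_independent by auto
  moreover have "card (S \<union> T) = card S + card T"
    using fin disj by (simp add: card_Un_disjoint)
  moreover have "S \<union> T \<subseteq> ?V"
    using S(1) T(1) subspace_0[OF A] subspace_0[OF B]
    by (auto, metis add.right_neutral subset_iff, metis add.left_neutral subset_iff)
  moreover have "?V \<subseteq> span (S \<union> T)"
    using S(3) T(3) span_mono[of S "S \<union> T"] span_mono[of T "S \<union> T"] by (auto intro!: span_add)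
  ultimately show "independent (S \<union> T)"
    by (intro card_le_dim_spanning[of _ ?V]) auto
qed

text \<open>Maps between subspaces are represented throughout by endomorphisms of the whole space.
  This glues two of them; off A + B the result is whatever the linear extension of a basis
  assignment gives.\<close>

lemma endo_direct_sum:
  assumes A: "subspace A" and B: "subspace B" and AB: "A \<inter> B \<subseteq> {0}" and f: "endo f" and g: "endo g"
  obtains h where "endo h" "\<And>x. x \<in> A \<Longrightarrow> h x = f x" "\<And>x. x \<in> B \<Longrightarrow> h x = g x"
proof -
  obtain S where S: "S \<subseteq> A" "independent S" "A \<subseteq> span S" using basis_exists by metis
  obtain T where T: "T \<subseteq> B" "independent T" "B \<subseteq> span T" using basis_exists by metis
  note ST = direct_sum_basis[OF A B AB S T]
  obtain h where h: "endo h" "\<forall>x\<in>S \<union> T. h x = (if x \<in> S then f x else g x)"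
    using vp.linear_independent_extend[OF ST(1), of "\<lambda>x. if x \<in> S then f x else g x"] by blast
  show thesis
  proof (rule that)
    show "endo h" by fact
    show "h x = f x" if "x \<in> A" for x
      by (rule vp.linear_eq_on_span[OF h(1) f, of S]) (use h S that in auto)
    show "h x = g x" if "x \<in> B" for x
      by (rule vp.linear_eq_on_span[OF h(1) g, of T]) (use h T ST(2) that in auto)
  qed
qed

lemma dim_direct_sum:
  assumes "subspace A" "subspace B" "A \<inter> B \<subseteq> {0}" "C = {x + y |x y. x \<in> A \<and> y \<in> B}"
  shows "dim C = dim A + dim B"
  unfolding assms(4) using dim_sums_Int[OF assms(1,2)] iffD2[OF dim_eq_0 assms(3)] by linarith

lemma dim_image_inj:
  assumes "endo f" "subspace S" "S \<inter> ker f \<subseteq> {0}"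
  shows "dim (f ` S) = dim S"
proof (rule vp.dim_image_eq[OF assms(1)])
  show "inj_on f (span S)"
    unfolding span_eq_iff[THEN iffD2, OF assms(2)]
    using assms(3) vp.linear_inj_on_iff_eq_0[OF assms(1,2)] by auto
qed

lemma rank_nullity_on:
  assumes f: "endo f" and S: "subspace S"
  shows "dim S = dim (f ` S) + dim (S \<inter> ker f)"
proof -
  have K: "subspace (S \<inter> ker f)"
    by (intro subspace_inter S subspace_ker f)
  obtain B where B: "B \<subseteq> S \<inter> ker f" "independent B" "S \<inter> ker f \<subseteq> span B"
    using basis_exists by metis
  obtain C where C: "B \<subseteq> C" "C \<subseteq> S" "independent C" "S \<subseteq> span C"
    using maximal_independent_subset_extend[of B S] B by auto
  have fin: "finite C" using C finiteI_independent by auto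
  let ?T = "span (C - B)"
  have TS: "?T \<subseteq> S" using C(2) S by (intro span_minimal) auto
  have cardC: "card B + card (C - B) = card C"
    using fin C(1) by (metis card_Diff_subset card_mono finite_subset le_add_diff_inverse)
  \<comment> \<open>Together the two spans generate span C, whose dimension is already the sum of
    theirs. So they meet in 0, and f is injective on \<open>?T\<close>.\<close>
  have "dim (?T \<inter> span B) = 0"
  proof -
    have "{x + y |x y. x \<in> ?T \<and> y \<in> span B} = span C"
      using C(1) by (simp add: span_Un[symmetric] Un_absorb2)
    then have "card C + dim (?T \<inter> span B) = card (C - B) + card B"
      using dim_sums_Int[of ?T "span B"] C(3) B(2) independent_mono[OF C(3), of "C - B"]
      by (simp add: dim_eq_card_independent)
    then show ?thesis using cardC by linarith
  qed
  then have 0: "?T \<inter> ker f \<subseteq> {0}" using B TS by auto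
  have "f ` S = f ` ?T"
  proof
    show "f ` S \<subseteq> f ` ?T"
    proof
      fix y assume "y \<in> f ` S"
      then obtain x where x: "x \<in> S" "y = f x" by blast
      have "x \<in> span ((C - B) \<union> B)" using C x by (metis Un_Diff_cancel2 le_iff_sup subset_Un_eq sup_commute subsetD)
      then obtain a b where "x = a + b" "a \<in> ?T" "b \<in> span B"
        unfolding span_Un by blast
      moreover have "f b = 0" if "b \<in> span B" for b
        using span_minimal[of B "ker f"] B(1) subspace_ker[OF f] that by auto
      ultimately show "y \<in> f ` ?T" using x by (auto simp: endo_add[OF f])
    qed
  qed (use TS in auto)
  then have "dim (f ` S) = dim ?T"
    using dim_image_inj[OF f _ 0] by simp
  also have "\<dots> = card (C - B)"
    using independent_mono[OF C(3)] by (intro dim_span_eq_card_independent) auto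
  finally have "dim (f ` S) = card (C - B)" .
  moreover have "dim S = card C" "dim (S \<inter> ker f) = card B"
    using basis_card_eq_dim[OF B(1,3,2)] basis_card_eq_dim[OF C(2,4,3)] by simp_all
  ultimately show ?thesis using cardC by simp
qed

text \<open>In terms of quotients: dim (f T / f S) is at most dim (T / S). The additive form keeps
  truncated subtraction away.\<close>

lemma dim_image_diff_le:
  assumes f: "endo f" and S: "subspace S" "subspace T" "S \<subseteq> T"
  shows "dim (f ` T) + dim S \<le> dim T + dim (f ` S)"
  using rank_nullity_on[OF f S(1)] rank_nullity_on[OF f S(2)]
    dim_subset[of "S \<inter> ker f" "T \<inter> ker f"] S(3) by fastforce

end

section \<open>Necessity of the intertwining condition\<close>

lemma funpow_swap: "(f ^^ j) ((f ^^ k) x) = (f ^^ k) ((f ^^ j) x)"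
proof -
  have "f ^^ j \<circ> f ^^ k = f ^^ k \<circ> f ^^ j" by (metis add.commute funpow_add)
  then show ?thesis by (simp add: fun_eq_iff)
qed

lemma funpow_commute:
  assumes "\<And>x. f (g x) = g (f x)"
  shows "(f ^^ k) (g x) = g ((f ^^ k) x)"
  using assms by (induction k) auto

lemma funpow_comp_commute:
  assumes "\<And>x. f (g x) = g (f x)"
  shows "((\<lambda>x. f (g x)) ^^ k) x = (f ^^ k) ((g ^^ k) x)"
  by (induction k) (auto simp: funpow_commute[of f g, OF assms])

lemma funpow_image_mono: "f ` S \<subseteq> S \<Longrightarrow> (f ^^ k) ` S \<subseteq> S"
  by (induction k) auto

context finite_dimensional_vector_space
begin

text \<open>On Ker f the map g is multiplication by c, so no power of g kills a nonzero vector
  there; the induction on k reduces to this case. Besides u - a and u - b, the lemma is later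
  applied to 4 (u - a) (u - b) and (2 u - a - b)^2.\<close>

lemma coprime_kernels:
  assumes f: "endo f" and g: "endo g" and gf: "\<And>x. g x = f x + scale c x" and c: "c \<noteq> 0"
    and "(f ^^ k) x = 0" "(g ^^ n) x = 0"
  shows "x = 0"
  using assms(5,6)
proof (induction k arbitrary: x)
  case (Suc k)
  have comm: "g (f y) = f (g y)" for y
    by (simp add: gf endo_simps[OF f])
  have "f x = 0"
  proof (rule Suc.IH)
    show "(f ^^ k) (f x) = 0" using Suc.prems(1) by (simp add: funpow_swap1)
    show "(g ^^ n) (f x) = 0"
      using Suc.prems(2) by (simp add: funpow_commute[of g f, OF comm] endo_zero[OF f])
  qed
  then have "(g ^^ m) x = scale (c ^ m) x" for m
    by (induction m) (simp_all add: gf endo_simps[OF f])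
  then show ?case using Suc.prems(2) c by simp
next
  case 0
  then show ?case by simp
qed

lemma dim_ker_comp_le:
  assumes f: "endo f" and g: "endo g"
  shows "dim (ker (\<lambda>x. f (g x))) \<le> dim (ker f) + dim (ker g)"
proof -
  let ?K = "ker (\<lambda>x. f (g x))"
  have "dim ?K = dim (g ` ?K) + dim (?K \<inter> ker g)"
    by (rule rank_nullity_on[OF g subspace_ker[OF endo_comp[OF f g]]])
  moreover have "dim (g ` ?K) \<le> dim (ker f)" by (intro dim_subset) auto
  moreover have "dim (?K \<inter> ker g) \<le> dim (ker g)" by (intro dim_subset) auto
  ultimately show ?thesis by linarith
qed

text \<open>
  With \<open>M = \<gamma> ` A\<close>, the module \<open>z\<^sup>2 A\<close> is a quotient of \<open>M\<close> and \<open>M\<close> is a submodule of \<open>B\<close>;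
  neither operation increases the number of Jordan blocks of size at least \<open>k + 1\<close>.
\<close>

lemma rank_drop_le:
  assumes z: "endo z" and \<beta>: "endo \<beta>" and \<gamma>: "endo \<gamma>" and A: "subspace A" and B: "subspace B"
    and \<gamma>A: "\<gamma> ` A \<subseteq> B" and zA: "z ` A \<subseteq> A" and \<beta>\<gamma>: "\<And>x. x \<in> A \<Longrightarrow> \<beta> (\<gamma> x) = z (z x)"
    and \<beta>z: "\<And>x. \<beta> (z x) = z (\<beta> x)" and \<gamma>z: "\<And>x. \<gamma> (z x) = z (\<gamma> x)"
  shows "dim ((z ^^ (k + 2)) ` A) + dim ((z ^^ (k + 1)) ` B)
    \<le> dim ((z ^^ k) ` B) + dim ((z ^^ (k + 3)) ` A)"
proof -
  let ?M = "\<gamma> ` A"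
  have M: "subspace ?M" by (intro subspace_image_endo \<gamma> A)
  have im: "\<beta> ` (z ^^ i) ` ?M = (z ^^ (i + 2)) ` A" for i
  proof -
    have "\<beta> ((z ^^ i) (\<gamma> x)) = (z ^^ (i + 2)) x" if "x \<in> A" for x
      using that by (simp add: funpow_commute[of z \<beta>, OF \<beta>z[symmetric], symmetric] \<beta>\<gamma> funpow_swap1)
    then show ?thesis by (auto simp: image_comp intro!: image_cong)
  qed
  have zM: "z ` ?M \<subseteq> ?M" using zA by (auto simp: \<gamma>z[symmetric])
  have "(z ^^ (k + 1)) ` ?M \<subseteq> (z ^^ k) ` ?M"
    using zM by (auto simp: funpow_swap1)
  from dim_image_diff_le[OF \<beta> subspace_image_endo[OF endo_pow[OF z] M] subspace_image_endo[OF endo_pow[OF z] M] this]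
  have "dim ((z ^^ (k + 2)) ` A) + dim ((z ^^ (k + 1)) ` ?M)
      \<le> dim ((z ^^ k) ` ?M) + dim ((z ^^ (k + 3)) ` A)"
    unfolding im by (simp only: add.assoc one_plus_numeral add_num_simps)
  \<comment> \<open>The rank drop from k to k + 1 is the dimension of the part of z^k S inside Ker
    z. In this form the count of blocks is visibly monotone in S.\<close>
  moreover have "dim ((z ^^ k) ` S) = dim ((z ^^ (k + 1)) ` S) + dim ((z ^^ k) ` S \<inter> ker z)"
    if "subspace S" for S
    using rank_nullity_on[OF z, of "(z ^^ k) ` S"]
    by (simp add: that subspace_image_endo endo_pow z image_comp)
  note this[OF M] this[OF B]
  moreover have "dim ((z ^^ k) ` ?M \<inter> ker z) \<le> dim ((z ^^ k) ` B \<inter> ker z)"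
    using \<gamma>A by (intro dim_subset) auto
  ultimately show ?thesis by linarith
qed

end

locale quadratic_difference = finite_dimensional_vector_space +
  fixes D N :: "'b \<Rightarrow> 'b" and a b :: 'a
  assumes D: "endo D" and N: "endo N" and NN: "\<And>x. N (N x) = 0"
    and DD: "\<And>x. D (D x) = scale (a + b) (D x) - scale (a * b) x" and ab: "a \<noteq> b"
begin

text \<open>For u = D - N this is (u - a) (u - b), expanded with the quadratic relations of D and N
  (see \<open>ww\<close>). The expression is symmetric in a and b, which makes the exchange of a and
  b below possible.\<close>

definition "z x = scale (a + b) (N x) - D (N x) - N (D x)"

lemmas DN = endo_simps[OF D] endo_simps[OF N]

lemma endo_z: "endo z"
  by (auto simp: endo_iff z_def DN algebra_simps)

lemma zD: "z (D x) = D (z x)" and zN: "z (N x) = N (z x)"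
  by (simp_all add: z_def DN DD NN algebra_simps)

abbreviation "w c \<equiv> \<lambda>x. D x - N x - scale c x"

lemma endo_w: "endo (w c)"
  by (auto simp: endo_iff DN algebra_simps)

lemma ww: "w b (w a x) = z x" "w a (w b x) = z x"
  by (simp_all add: z_def DN DD NN algebra_simps)

lemma z_pow: "(z ^^ k) x = (w b ^^ k) ((w a ^^ k) x)"
proof -
  have "z = (\<lambda>x. w b (w a x))" by (simp add: ww)
  then show ?thesis using funpow_comp_commute[of "w b" "w a" k x] by (simp only: ww)
qed

abbreviation "E c \<equiv> ker (\<lambda>x. D x - scale c x)"

lemma subspace_E: "subspace (E c)"
  by (intro subspace_ker endo_shift D)

lemma zE: "z ` E c \<subseteq> E c"
  by (auto simp: zD[symmetric] endo_scale[OF endo_z])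

text \<open>Induction through z = (u - b) (u - a), which preserves \<open>E b\<close> and lowers k.
  In the end x is an eigenvector of u at a and of D at b, so the nilpotent N acts on it as the
  nonzero scalar b - a.\<close>

lemma ker_w_inter_E: "(w a ^^ k) x = 0 \<Longrightarrow> x \<in> E b \<Longrightarrow> x = 0"
proof (induction k arbitrary: x)
  case (Suc k)
  have comm: "w a (w b y) = w b (w a y)" for y
    by (simp add: ww)
  have "(w a ^^ k) (z x) = w b ((w a ^^ Suc k) x)"
    by (simp only: funpow_Suc_right o_apply ww[symmetric] funpow_commute[of "w a" "w b", OF comm])
  then have "(w a ^^ k) (z x) = 0" by (simp only: Suc.prems(1) endo_zero[OF endo_w])
  moreover have "z x \<in> E b" using zE Suc.prems by blast
  ultimately have "z x = 0" by (rule Suc.IH)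
  have "w a x = 0"
  proof (rule coprime_kernels[OF endo_w endo_w, of b a "a - b" k _ 1])
    show "(w a ^^ k) (w a x) = 0"
      using Suc.prems(1) by (simp only: funpow_Suc_right o_apply)
    show "(w b ^^ 1) (w a x) = 0"
      using \<open>z x = 0\<close> by (simp add: ww)
  qed (use ab in \<open>simp_all add: scale_left_diff_distrib\<close>)
  then have "N x = scale (b - a) x" using Suc.prems(2) by (simp add: algebra_simps)
  then show ?case using NN[of x] ab by (simp add: DN)
next
  case 0
  then show ?case by simp
qed

text \<open>The injection is D - b: it maps into \<open>E a\<close>, its kernel \<open>E b\<close>
  meets Ker (u - a)^k only in 0, and it commutes with z, whose k-th power vanishes on Ker (u -
  a)^k.\<close>

lemma dim_ker_w_le: "dim (ker (w a ^^ k)) \<le> dim (E a \<inter> ker (z ^^ k))"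
proof -
  let ?P = "\<lambda>x. D x - scale b x"
  have 1: "dim (?P ` ker (w a ^^ k)) = dim (ker (w a ^^ k))"
    using ker_w_inter_E[of k] by (intro dim_image_inj endo_shift D subspace_ker endo_pow endo_w) auto
  have "?P x \<in> E a \<inter> ker (z ^^ k)" if x: "(w a ^^ k) x = 0" for x
  proof -
    have "(z ^^ k) (D x - scale b x) = D ((z ^^ k) x) - scale b ((z ^^ k) x)"
      by (simp add: endo_simps[OF endo_pow[OF endo_z]] funpow_commute[of z D, OF zD])
    moreover have "(z ^^ k) x = 0" using x by (simp add: z_pow endo_zero[OF endo_pow[OF endo_w]])
    ultimately show ?thesis
      by (simp add: DN DD algebra_simps)
  qed
  then have "?P ` ker (w a ^^ k) \<subseteq> E a \<inter> ker (z ^^ k)" by blast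
  from dim_subset[OF this] show ?thesis unfolding 1 .
qed

lemma rank_drop_le_E:
  "dim ((z ^^ (k + 2)) ` E a) + dim ((z ^^ (k + 1)) ` E b)
    \<le> dim ((z ^^ k) ` E b) + dim ((z ^^ (k + 3)) ` E a)"
proof (rule rank_drop_le[where \<beta> = "\<lambda>x. D (N x) - scale b (N x)" and \<gamma> = "\<lambda>x. D (N x) - scale a (N x)"])
  show "endo z" "subspace (E a)" "subspace (E b)" "z ` E a \<subseteq> E a"
    by (rule endo_z subspace_E zE)+
  show "endo (\<lambda>x. D (N x) - scale b (N x))" "endo (\<lambda>x. D (N x) - scale a (N x))"
    by (auto simp: endo_iff DN algebra_simps)
  show "(\<lambda>x. D (N x) - scale a (N x)) ` E a \<subseteq> E b"
    by (auto simp: DN DD algebra_simps)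
  show "D (N (z x)) - scale b (N (z x)) = z (D (N x) - scale b (N x))" for x
    by (simp add: endo_simps[OF endo_z] zD zN)
  show "D (N (z x)) - scale a (N (z x)) = z (D (N x) - scale a (N x))" for x
    by (simp add: endo_simps[OF endo_z] zD zN)
  show "D (N (D (N x) - scale a (N x))) - scale b (N (D (N x) - scale a (N x))) = z (z x)"
    if "x \<in> E a" for x
  proof -
    have Dx: "D x = scale a x" using that by simp
    \<comment> \<open>Applying N to the definition of z leaves only - N D N, as N^2 = 0. Hence (D -
      b) N (D - a) N = (b - D) N z, and b N - D N is z itself on \<open>E a\<close>.\<close>
    have NDN: "N (D (N y)) = - N (z y)" for y
      by (simp add: z_def DN NN algebra_simps)
    have zx: "z x = scale b (N x) - D (N x)"
      by (simp add: z_def Dx DN algebra_simps)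
    have "D (N (D (N x) - scale a (N x))) - scale b (N (D (N x) - scale a (N x)))
      = scale b (N (z x)) - D (N (z x))"
      by (simp add: DN NN NDN algebra_simps)
    also have "\<dots> = z (scale b (N x) - D (N x))"
      by (simp add: endo_simps[OF endo_z] zD zN)
    finally show ?thesis using zx by simp
  qed
qed

text \<open>Both intersections lie in Ker z^k and are independent, while z^k = (u - b)^k (u - a)^k
  bounds the dimension of that kernel. This reverses only the sum of the two inequalities of
  \<open>dim_ker_w_le\<close>, at a and at b, which is enough to make both equalities.\<close>

lemma sum_dim_E_le: "dim (E a \<inter> ker (z ^^ k)) + dim (E b \<inter> ker (z ^^ k))
  \<le> dim (ker (w a ^^ k)) + dim (ker (w b ^^ k))"
proof -
  let ?A = "E a \<inter> ker (z ^^ k)" and ?B = "E b \<inter> ker (z ^^ k)"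
  have K: "subspace (ker (z ^^ k))" by (intro subspace_ker endo_pow endo_z)
  have "?A \<inter> ?B \<subseteq> {0}" using ab by auto
  then have "dim ?A + dim ?B = dim {x + y |x y. x \<in> ?A \<and> y \<in> ?B}"
    by (intro dim_direct_sum[symmetric] subspace_inter subspace_E K) auto
  also have "\<dots> \<le> dim (ker (z ^^ k))"
    using subspace_add[OF K] by (intro dim_subset) blast
  also have "\<dots> \<le> dim (ker (w b ^^ k)) + dim (ker (w a ^^ k))"
    unfolding z_pow by (intro dim_ker_comp_le endo_pow endo_w)
  finally show ?thesis by simp
qed

lemma rank_nullity_E: "dim (E c) = dim ((z ^^ k) ` E c) + dim (E c \<inter> ker (z ^^ k))"
  by (intro rank_nullity_on endo_pow endo_z subspace_E)

end

text \<open>The exchange of a and b. Rewriting the second z to the first lets facts from both sides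
  be combined.\<close>

sublocale quadratic_difference \<subseteq> swap: quadratic_difference scale Basis D N b a
  rewrites "quadratic_difference.z scale D N b a = z"
proof -
  show *: "quadratic_difference scale Basis D N b a"
    by (intro quadratic_difference.intro finite_dimensional_vector_space_axioms
        quadratic_difference_axioms.intro D N NN ab[symmetric])
      (simp add: DD add.commute mult.commute)
  show "quadratic_difference.z scale D N b a = z"
    by (rule ext) (simp add: z_def quadratic_difference.z_def[OF *] add.commute)
qed

context quadratic_difference
begin

lemma dim_ker_w: "dim (ker (w a ^^ k)) = dim (E a \<inter> ker (z ^^ k))"
  using dim_ker_w_le[of k] swap.dim_ker_w_le[of k] sum_dim_E_le[of k] by linarith

lemma jordan_count_eq:
  "jordan_count scale (\<lambda>x. D x - N x) a (Suc k) = dim ((z ^^ k) ` E a) - dim ((z ^^ Suc k) ` E a)"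
  unfolding jordan_count_def ker_pow_def diff_Suc_1 dim_ker_w
  using rank_nullity_E[of a k] rank_nullity_E[of a "Suc k"] by linarith

end

context quadratic_difference
begin

lemma jordan_count_le:
  "jordan_count scale (\<lambda>x. D x - N x) a (Suc k + 2) \<le> jordan_count scale (\<lambda>x. D x - N x) b (Suc k)"
proof -
  have 1: "jordan_count scale (\<lambda>x. D x - N x) a (Suc k + 2)
      = dim ((z ^^ (k + 2)) ` E a) - dim ((z ^^ (k + 3)) ` E a)"
    using jordan_count_eq[of "k + 2"] by (simp del: funpow.simps add: eval_nat_numeral)
  have 2: "jordan_count scale (\<lambda>x. D x - N x) b (Suc k)
      = dim ((z ^^ k) ` E b) - dim ((z ^^ (k + 1)) ` E b)"
    using swap.jordan_count_eq[of k] by (simp del: funpow.simps)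
  show ?thesis
    using rank_drop_le_E[of k] unfolding 1 2 by linarith
qed

end

context quadratic_difference
begin

theorem intertwined_jordan_count:
  "intertwined 2 (jordan_count scale (\<lambda>x. D x - N x) a) (jordan_count scale (\<lambda>x. D x - N x) b)"
  unfolding intertwined_def
proof (intro allI impI)
  fix n :: nat assume "1 \<le> n"
  then obtain k where "n = Suc k" by (cases n) auto
  then show "jordan_count scale (\<lambda>x. D x - N x) a (n + 2) \<le> jordan_count scale (\<lambda>x. D x - N x) b n \<and>
      jordan_count scale (\<lambda>x. D x - N x) b (n + 2) \<le> jordan_count scale (\<lambda>x. D x - N x) a n"
    using jordan_count_le swap.jordan_count_le by blast
qed

end

section \<open>Pairs of nilpotent endomorphisms\<close>

context finite_dimensional_vector_space
begin

interpretation vp: finite_dimensional_vector_space_pair scale Basis scale Basis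
  by unfold_locales

text \<open>The value a = 0 forces e = 0, so the zero space is spanned by a chain of length 0 and a
  longest chain can be split off from any space.\<close>

definition nil_order :: "('b \<Rightarrow> 'b) \<Rightarrow> 'b \<Rightarrow> nat \<Rightarrow> bool" where
  "nil_order f e a \<longleftrightarrow> (f ^^ a) e = 0 \<and> (a > 0 \<longrightarrow> (f ^^ (a - 1)) e \<noteq> 0)"

definition chain :: "('b \<Rightarrow> 'b) \<Rightarrow> 'b \<Rightarrow> nat \<Rightarrow> 'b set" where
  "chain f e a = (\<lambda>j. (f ^^ j) e) ` {..<a}"

lemma nil_order_pow_eq_0:
  assumes "endo f" "nil_order f e a" "a \<le> j"
  shows "(f ^^ j) e = 0"
proof -
  have "(f ^^ j) e = (f ^^ (j - a)) ((f ^^ a) e)"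
    using assms(3) by (metis comp_apply funpow_add le_add_diff_inverse2)
  then show ?thesis using assms(2) endo_zero[OF endo_pow[OF assms(1)]] by (simp add: nil_order_def)
qed

lemma nil_order_shift:
  assumes "endo f" "nil_order f e a"
  shows "nil_order f ((f ^^ k) e) (a - k)"
proof -
  have "(f ^^ j) ((f ^^ k) e) = (f ^^ (j + k)) e" for j
    by (simp add: funpow_add)
  then show ?thesis
    using assms(2) nil_order_pow_eq_0[OF assms, of "a - k + k"] by (auto simp: nil_order_def)
qed

text \<open>Induction on the length: f e starts a chain shorter by one. If the whole chain has
  length a + 1, this shorter one lies in Ker f^a, whereas f^a e is nonzero.\<close>

lemma chain_independent:
  assumes "endo f" "nil_order f e a"
  shows "independent (chain f e a) \<and> inj_on (\<lambda>j. (f ^^ j) e) {..<a}"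
  using assms(2)
proof (induction a arbitrary: e)
  case 0
  then show ?case by (simp add: chain_def independent_empty)
next
  case (Suc a)
  have IH: "independent (chain f (f e) a)" "inj_on (\<lambda>j. (f ^^ j) (f e)) {..<a}"
    using Suc.IH[of "f e"] nil_order_shift[OF assms(1) Suc.prems, of 1] by simp_all
  have nz: "(f ^^ a) e \<noteq> 0" using Suc.prems by (simp add: nil_order_def)
  have "chain f (f e) a \<subseteq> ker (f ^^ a)"
  proof -
    have "(f ^^ a) ((f ^^ j) (f e)) = (f ^^ (a + Suc j)) e" for j
      by (simp only: funpow_add funpow_Suc_right o_apply)
    moreover have "(f ^^ (a + Suc j)) e = 0" for j
      by (rule nil_order_pow_eq_0[OF assms(1) Suc.prems]) simp
    ultimately show ?thesis by (auto simp: chain_def)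
  qed
  then have "span (chain f (f e) a) \<subseteq> ker (f ^^ a)"
    by (intro span_minimal subspace_ker endo_pow assms)
  with nz have notin: "e \<notin> span (chain f (f e) a)" by auto
  have eq: "chain f e (Suc a) = insert e (chain f (f e) a)"
    by (auto simp: chain_def lessThan_Suc_eq_insert_0 image_image funpow_swap1)
  have "inj_on (\<lambda>j. (f ^^ j) e) (insert 0 (Suc ` {..<a}))"
  proof (subst inj_on_insert, intro conjI)
    show "inj_on (\<lambda>j. (f ^^ j) e) (Suc ` {..<a})"
      using IH(2) by (auto simp: inj_on_def funpow_swap1)
    have "(f ^^ 0) e \<notin> chain f (f e) a" using notin span_base by auto
    then show "(f ^^ 0) e \<notin> (\<lambda>j. (f ^^ j) e) ` (Suc ` {..<a} - {0})"
      by (auto simp: chain_def funpow_swap1)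
  qed
  then show ?case
    unfolding eq using IH(1) notin by (simp add: independent_insertI lessThan_Suc_eq_insert_0)
qed

text \<open>The power f^k turns the chain of e into that of f^k e. The truncated difference is
  intended: it is 0 once k reaches a.\<close>

lemma dim_image_span_chain:
  assumes f: "endo f" and e: "nil_order f e a"
  shows "dim ((f ^^ k) ` span (chain f e a)) = a - k"
proof -
  let ?c = "chain f ((f ^^ k) e) (a - k)"
  have pow: "(f ^^ k) ((f ^^ j) e) = (f ^^ (k + j)) e" "(f ^^ j) ((f ^^ k) e) = (f ^^ (k + j)) e" for j
    by (simp add: funpow_add) (metis add.commute comp_apply funpow_add)
  have "(f ^^ k) ` chain f e a \<subseteq> span ?c"
  proof -
    have "(f ^^ (k + j)) e \<in> span ?c" for j
    proof (cases "j < a - k")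
      case True
      then show ?thesis by (intro span_base) (auto simp: chain_def pow)
    next
      case False
      then show ?thesis using nil_order_pow_eq_0[OF f e, of "k + j"] by (simp add: span_zero)
    qed
    then show ?thesis by (auto simp: chain_def pow)
  qed
  moreover have "?c \<subseteq> (f ^^ k) ` chain f e a"
    by (force simp: chain_def pow)
  ultimately have "span ((f ^^ k) ` chain f e a) = span ?c"
    by (metis span_mono span_minimal subspace_span subset_antisym)
  then have "(f ^^ k) ` span (chain f e a) = span ?c"
    using vp.linear_span_image[OF endo_pow[OF f]] by simp
  moreover have "independent ?c" "card ?c = a - k"
    using chain_independent[OF f nil_order_shift[OF f e, of k]] by (auto simp: chain_def card_image)
  ultimately show ?thesis by (metis dim_span_eq_card_independent)
qed

lemma span_chain_invariant:
  assumes "endo f" "nil_order f e a"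
  shows "f ` span (chain f e a) \<subseteq> span (chain f e a)"
proof -
  have "(f ^^ Suc j) e \<in> span (chain f e a)" for j
  proof (cases "Suc j < a")
    case True
    then show ?thesis by (intro span_base) (auto simp: chain_def simp del: funpow.simps)
  next
    case False
    then show ?thesis using nil_order_pow_eq_0[OF assms, of "Suc j"] by (simp add: span_zero)
  qed
  then have "f ` chain f e a \<subseteq> span (chain f e a)" by (auto simp: chain_def)
  then show ?thesis
    using vp.linear_span_image[OF assms(1)] by (metis span_minimal subspace_span)
qed

text \<open>A longest Jordan chain has an invariant complement. Let \<phi> be a functional equal to
  1 on the last vector of the chain and to 0 on the others; the complement consists of the x in A
  with \<phi> zero on all iterates of x. It is stable under f because f^a = 0 on A, which is where
  the maximal length enters.\<close>

lemma nilpotent_split: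
  assumes f: "endo f" and A: "subspace A" and fA: "f ` A \<subseteq> A" and nil: "(f ^^ n) ` A \<subseteq> {0}"
  obtains a e A' where "nil_order f e a" "span (chain f e a) \<subseteq> A" "(f ^^ a) ` A \<subseteq> {0}"
    "subspace A'" "f ` A' \<subseteq> A'" "span (chain f e a) \<inter> A' \<subseteq> {0}"
    "A = {x + y |x y. x \<in> span (chain f e a) \<and> y \<in> A'}"
proof -
  interpret fn: vector_space_pair scale "(*) :: 'a \<Rightarrow> 'a \<Rightarrow> 'a"
    by unfold_locales (auto simp: algebra_simps)
  define a where "a = (LEAST a. (f ^^ a) ` A \<subseteq> {0})"
  have a: "(f ^^ a) ` A \<subseteq> {0}" unfolding a_def by (rule LeastI) (fact nil)
  have "\<exists>e\<in>A. nil_order f e a"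
  proof (cases a)
    case 0
    then show ?thesis using subspace_0[OF A] by (auto simp: nil_order_def)
  next
    case (Suc m)
    then have "\<not> (f ^^ m) ` A \<subseteq> {0}"
      using not_less_Least[of m "\<lambda>a. (f ^^ a) ` A \<subseteq> {0}"] by (simp add: a_def)
    then show ?thesis using a Suc by (fastforce simp: nil_order_def)
  qed
  then obtain e where eA: "e \<in> A" and e: "nil_order f e a" by blast
  let ?C = "span (chain f e a)"
  note ind = chain_independent[OF f e]
  have CA: "?C \<subseteq> A"
  proof (rule span_minimal[OF _ A])
    show "chain f e a \<subseteq> A" using funpow_image_mono[OF fA] eA by (auto simp: chain_def)
  qed
  obtain \<phi> where \<phi>: "Vector_Spaces.linear scale (*) \<phi>"
    and \<phi>_chain: "\<forall>x\<in>chain f e a. \<phi> x = (if x = (f ^^ (a - 1)) e then 1 else 0)"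
    using fn.linear_independent_extend[of "chain f e a" "\<lambda>x. if x = (f ^^ (a - 1)) e then 1 else 0"] ind
    by blast
  note \<phi>_simps = fn.linear_add[OF \<phi>] fn.linear_diff[OF \<phi>] fn.linear_scale[OF \<phi>] fn.linear_0[OF \<phi>]
  have \<phi>_pow: "\<phi> ((f ^^ j) e) = (if Suc j = a then 1 else 0)" for j
  proof (cases "j < a")
    case True
    then have "(f ^^ j) e = (f ^^ (a - 1)) e \<longleftrightarrow> j = a - 1"
      using ind by (auto simp: inj_on_def)
    moreover have "(f ^^ j) e \<in> chain f e a" using True by (auto simp: chain_def)
    ultimately show ?thesis using \<phi>_chain True by auto
  next
    case False
    then show ?thesis using nil_order_pow_eq_0[OF f e, of j] \<phi>_simps(4) by simp
  qed
  define A' where "A' = {x\<in>A. \<forall>j<a. \<phi> ((f ^^ j) x) = 0}"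
  \<comment> \<open>The projection onto the chain along A': the coordinate at f^i e is read off by
    \<phi> after the shift f^(a - 1 - i), which moves that vector to the end of the chain.\<close>
  define \<pi> where "\<pi> x = (\<Sum>i<a. scale (\<phi> ((f ^^ (a - 1 - i)) x)) ((f ^^ i) e))" for x
  note fp = endo_simps[OF endo_pow[OF f]]
  have \<pi>C: "\<pi> x \<in> ?C" for x
    unfolding \<pi>_def by (intro span_sum span_scale span_base) (auto simp: chain_def)
  have \<pi>: "endo \<pi>"
    by (rule endoI) (simp_all add: \<pi>_def fp \<phi>_simps scale_left_distrib sum.distrib scale_sum_right)
  have \<pi>_id: "\<pi> x = x" if "x \<in> ?C" for x
  proof -
    have "\<pi> ((f ^^ j) e) = (f ^^ j) e" if "j < a" for j
    proof -
      have pow: "(f ^^ (a - 1 - i)) ((f ^^ j) e) = (f ^^ (a - 1 - i + j)) e" for i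
        by (simp add: funpow_add)
      have "\<phi> ((f ^^ (a - 1 - i)) ((f ^^ j) e)) = (if i = j then 1 else 0)" if "i < a" for i
        unfolding pow \<phi>_pow using \<open>j < a\<close> that by auto
      then have "\<pi> ((f ^^ j) e) = (\<Sum>i<a. if i = j then (f ^^ i) e else 0)"
        unfolding \<pi>_def by (intro sum.cong) auto
      then show ?thesis using that by simp
    qed
    then show ?thesis
      using vp.linear_eq_on_span[OF \<pi> linear_id, of "chain f e a" x] that by (auto simp: chain_def)
  qed
  have \<phi>\<pi>: "\<phi> ((f ^^ j) (\<pi> x)) = \<phi> ((f ^^ j) x)" if "j < a" for j x
  proof -
    have "\<phi> ((f ^^ j) (\<pi> x)) = (\<Sum>i<a. \<phi> ((f ^^ (a - 1 - i)) x) * \<phi> ((f ^^ (j + i)) e))"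
      by (simp add: \<pi>_def endo_sum[OF endo_pow[OF f]] fn.linear_sum[OF \<phi>] fp \<phi>_simps funpow_add)
    also have "\<dots> = (\<Sum>i<a. if i = a - 1 - j then \<phi> ((f ^^ j) x) else 0)"
      using that by (intro sum.cong) (auto simp: \<phi>_pow)
    also have "\<dots> = \<phi> ((f ^^ j) x)" using that by simp
    finally show ?thesis .
  qed
  show thesis
  proof
    show "nil_order f e a" "?C \<subseteq> A" "(f ^^ a) ` A \<subseteq> {0}" by fact+
    show "subspace A'"
      using A by (auto simp: subspace_def A'_def fp \<phi>_simps)
    show "f ` A' \<subseteq> A'"
    proof clarify
      fix x assume x: "x \<in> A'"
      have "\<phi> ((f ^^ j) (f x)) = 0" if "j < a" for j
      proof (cases "Suc j = a")
        case True
        then have "(f ^^ j) (f x) = 0" using a x by (auto simp: A'_def funpow_swap1)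
        then show ?thesis by (simp add: \<phi>_simps)
      next
        case False
        then have "\<phi> ((f ^^ Suc j) x) = 0" using x that by (simp add: A'_def del: funpow.simps)
        then show ?thesis by (simp add: funpow_swap1)
      qed
      then show "f x \<in> A'" using x fA by (auto simp: A'_def)
    qed
    show "?C \<inter> A' \<subseteq> {0}"
    proof
      fix x assume x: "x \<in> ?C \<inter> A'"
      then have "\<pi> x = 0" by (simp add: \<pi>_def A'_def)
      then show "x \<in> {0}" using \<pi>_id x by simp
    qed
    show "A = {x + y |x y. x \<in> ?C \<and> y \<in> A'}"
    proof
      show "A \<subseteq> {x + y |x y. x \<in> ?C \<and> y \<in> A'}"
      proof
        fix x assume x: "x \<in> A"
        have "x - \<pi> x \<in> A'"
          using x \<pi>C CA subspace_diff[OF A] by (auto simp: A'_def fp \<phi>_simps \<phi>\<pi>)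
        moreover have "x = \<pi> x + (x - \<pi> x)" by simp
        ultimately show "x \<in> {x + y |x y. x \<in> ?C \<and> y \<in> A'}" using \<pi>C by blast
      qed
      show "{x + y |x y. x \<in> ?C \<and> y \<in> A'} \<subseteq> A"
        using CA subspace_add[OF A] by (auto simp: A'_def)
    qed
  qed
qed

lemma dim_image_direct_sum:
  assumes f: "endo f" and A: "subspace A\<^sub>1" "subspace A\<^sub>2" "f ` A\<^sub>1 \<subseteq> A\<^sub>1" "f ` A\<^sub>2 \<subseteq> A\<^sub>2"
    "A\<^sub>1 \<inter> A\<^sub>2 \<subseteq> {0}" "A = {x + y |x y. x \<in> A\<^sub>1 \<and> y \<in> A\<^sub>2}"
  shows "dim ((f ^^ k) ` A) = dim ((f ^^ k) ` A\<^sub>1) + dim ((f ^^ k) ` A\<^sub>2)"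
proof (rule dim_direct_sum)
  show "subspace ((f ^^ k) ` A\<^sub>1)" "subspace ((f ^^ k) ` A\<^sub>2)"
    by (intro subspace_image_endo endo_pow f A)+
  show "(f ^^ k) ` A\<^sub>1 \<inter> (f ^^ k) ` A\<^sub>2 \<subseteq> {0}"
    using funpow_image_mono[OF A(3), of k] funpow_image_mono[OF A(4), of k] A(5) by blast
  have add: "(f ^^ k) (x + y) = (f ^^ k) x + (f ^^ k) y" for x y
    by (rule endo_add[OF endo_pow[OF f]])
  show "(f ^^ k) ` A = {x + y |x y. x \<in> (f ^^ k) ` A\<^sub>1 \<and> y \<in> (f ^^ k) ` A\<^sub>2}"
  proof (intro equalityI subsetI)
    fix z assume "z \<in> (f ^^ k) ` A"
    then obtain x y where "x \<in> A\<^sub>1" "y \<in> A\<^sub>2" "z = (f ^^ k) x + (f ^^ k) y"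
      unfolding A(6) by (auto simp: add)
    then show "z \<in> {x + y |x y. x \<in> (f ^^ k) ` A\<^sub>1 \<and> y \<in> (f ^^ k) ` A\<^sub>2}" by blast
  next
    fix z assume "z \<in> {x + y |x y. x \<in> (f ^^ k) ` A\<^sub>1 \<and> y \<in> (f ^^ k) ` A\<^sub>2}"
    then obtain x y where "x \<in> A\<^sub>1" "y \<in> A\<^sub>2" "z = (f ^^ k) (x + y)" by (auto simp: add)
    then show "z \<in> (f ^^ k) ` A" unfolding A(6) by blast
  qed
qed

text \<open>\<gamma> and \<beta> are homomorphisms between A and B as modules over the polynomial
  ring, acting through f and g. They are total endomorphisms, constrained on A and B only.\<close>

definition linked :: "('b \<Rightarrow> 'b) \<Rightarrow> 'b set \<Rightarrow> ('b \<Rightarrow> 'b) \<Rightarrow> 'b set \<Rightarrow> bool" where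
  "linked f A g B \<longleftrightarrow> (\<exists>\<gamma> \<beta>. endo \<gamma> \<and> endo \<beta> \<and>
     (\<forall>x\<in>A. \<gamma> x \<in> B \<and> \<gamma> (f x) = g (\<gamma> x) \<and> \<beta> (\<gamma> x) = f (f x)) \<and>
     (\<forall>y\<in>B. \<beta> y \<in> A \<and> \<beta> (g y) = f (\<beta> y) \<and> \<gamma> (\<beta> y) = g (g y)))"

lemma linked_sym: "linked f A g B \<Longrightarrow> linked g B f A"
  unfolding linked_def by blast

text \<open>Take \<gamma> e = e' and \<beta> e' = f^2 e. The first is consistent because g^a e' = 0,
  as b \<le> a; the second because f^(b + 2) e = 0, as a \<le> b + 2.\<close>

lemma linked_chain:
  assumes f: "endo f" and g: "endo g" and e: "nil_order f e a" and e': "nil_order g e' b"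
    and ab: "b \<le> a" "a \<le> b + 2"
  shows "linked f (span (chain f e a)) g (span (chain g e' b))"
proof -
  \<comment> \<open>Prescribes the values on all iterates of e at once. Beyond the end of the chain
    both sides are 0, so the identities below need no case distinction on j.\<close>
  have extend: "\<exists>\<gamma>. endo \<gamma> \<and> (\<forall>j. \<gamma> ((f ^^ j) e) = h j)"
    if f: "endo f" and e: "nil_order f e a" and h: "\<And>j. a \<le> j \<Longrightarrow> h j = 0" for f e a and h :: "nat \<Rightarrow> 'b"
  proof -
    let ?p = "\<lambda>j. (f ^^ j) e"
    obtain \<gamma> where \<gamma>: "endo \<gamma>" "\<forall>x\<in>chain f e a. \<gamma> x = h (inv_into {..<a} ?p x)"
      using vp.linear_independent_extend[of "chain f e a" "\<lambda>x. h (inv_into {..<a} ?p x)"]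
        chain_independent[OF f e] by blast
    have "\<gamma> (?p j) = h j" for j
    proof (cases "j < a")
      case True
      then have "inv_into {..<a} ?p (?p j) = j"
        using chain_independent[OF f e] by (intro inv_into_f_f) auto
      then show ?thesis using \<gamma>(2) True by (auto simp: chain_def)
    next
      case False
      then show ?thesis
        using nil_order_pow_eq_0[OF f e, of j] h[of j] endo_zero[OF \<gamma>(1)] by simp
    qed
    then show ?thesis using \<gamma>(1) by blast
  qed
  have "(g ^^ j) e' = 0" if "a \<le> j" for j
    using nil_order_pow_eq_0[OF g e', of j] ab that by simp
  from extend[OF f e, of "\<lambda>j. (g ^^ j) e'", OF this]
  obtain \<gamma> where \<gamma>: "endo \<gamma>" "\<And>j. \<gamma> ((f ^^ j) e) = (g ^^ j) e'" by blast
  have "(f ^^ (j + 2)) e = 0" if "b \<le> j" for j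
    by (rule nil_order_pow_eq_0[OF f e]) (use ab that in simp)
  from extend[OF g e', of "\<lambda>j. (f ^^ (j + 2)) e", OF this]
  obtain \<beta> where \<beta>: "endo \<beta>" "\<And>j. \<beta> ((g ^^ j) e') = (f ^^ (j + 2)) e" by blast
  have f2: "f (f ((f ^^ j) e)) = (f ^^ (j + 2)) e" for j by simp
  have g2: "g (g ((g ^^ j) e')) = (g ^^ (j + 2)) e'" for j by simp
  have f1: "f ((f ^^ j) e) = (f ^^ (Suc j)) e" for j by simp
  have g1: "g ((g ^^ j) e') = (g ^^ (Suc j)) e'" for j by simp
  have f_span: "(f ^^ j) e \<in> span (chain f e a)" for j
    using nil_order_pow_eq_0[OF f e, of j] by (cases "j < a") (auto simp: chain_def span_zero intro: span_base)
  have g_span: "(g ^^ j) e' \<in> span (chain g e' b)" for j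
    using nil_order_pow_eq_0[OF g e', of j] by (cases "j < b") (auto simp: chain_def span_zero intro: span_base)
  have "\<gamma> ` span (chain f e a) \<subseteq> span (chain g e' b)"
    unfolding vp.linear_span_image[OF \<gamma>(1), symmetric]
    by (rule span_minimal) (use g_span in \<open>auto simp: chain_def \<gamma>(2)\<close>)
  moreover have "\<beta> ` span (chain g e' b) \<subseteq> span (chain f e a)"
    unfolding vp.linear_span_image[OF \<beta>(1), symmetric]
    by (rule span_minimal) (use f_span in \<open>auto simp: chain_def \<beta>(2) simp del: funpow.simps\<close>)
  moreover have "\<gamma> (f x) = g (\<gamma> x)" if x: "x \<in> span (chain f e a)" for x
    by (rule vp.linear_eq_on_span[OF endo_comp[OF \<gamma>(1) f] endo_comp[OF g \<gamma>(1)] _ x])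
      (auto simp: chain_def f1 g1 \<gamma>(2) simp del: funpow.simps)
  moreover have "\<beta> (\<gamma> x) = f (f x)" if x: "x \<in> span (chain f e a)" for x
    by (rule vp.linear_eq_on_span[OF endo_comp[OF \<beta>(1) \<gamma>(1)] endo_comp[OF f f] _ x])
      (auto simp: chain_def f2 \<beta>(2) \<gamma>(2) simp del: funpow.simps)
  moreover have "\<beta> (g y) = f (\<beta> y)" if y: "y \<in> span (chain g e' b)" for y
    by (rule vp.linear_eq_on_span[OF endo_comp[OF \<beta>(1) g] endo_comp[OF f \<beta>(1)] _ y])
      (auto simp: chain_def g1 f1 \<beta>(2) simp del: funpow.simps)
  moreover have "\<gamma> (\<beta> y) = g (g y)" if y: "y \<in> span (chain g e' b)" for y
    by (rule vp.linear_eq_on_span[OF endo_comp[OF \<gamma>(1) \<beta>(1)] endo_comp[OF g g] _ y])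
      (auto simp: chain_def g2 \<beta>(2) \<gamma>(2) simp del: funpow.simps)
  ultimately show ?thesis
    unfolding linked_def using \<gamma>(1) \<beta>(1) by blast
qed

lemma linked_direct_sum:
  assumes f: "endo f" and g: "endo g"
    and A: "subspace A\<^sub>1" "subspace A\<^sub>2" "f ` A\<^sub>1 \<subseteq> A\<^sub>1" "f ` A\<^sub>2 \<subseteq> A\<^sub>2"
      "A\<^sub>1 \<inter> A\<^sub>2 \<subseteq> {0}" "A = {x + y |x y. x \<in> A\<^sub>1 \<and> y \<in> A\<^sub>2}"
    and B: "subspace B\<^sub>1" "subspace B\<^sub>2" "g ` B\<^sub>1 \<subseteq> B\<^sub>1" "g ` B\<^sub>2 \<subseteq> B\<^sub>2"
      "B\<^sub>1 \<inter> B\<^sub>2 \<subseteq> {0}" "B = {x + y |x y. x \<in> B\<^sub>1 \<and> y \<in> B\<^sub>2}"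
    and l1: "linked f A\<^sub>1 g B\<^sub>1" and l2: "linked f A\<^sub>2 g B\<^sub>2"
  shows "linked f A g B"
proof -
  from l1 obtain \<gamma>\<^sub>1 \<beta>\<^sub>1 where 1: "endo \<gamma>\<^sub>1" "endo \<beta>\<^sub>1"
    "\<And>x. x \<in> A\<^sub>1 \<Longrightarrow> \<gamma>\<^sub>1 x \<in> B\<^sub>1 \<and> \<gamma>\<^sub>1 (f x) = g (\<gamma>\<^sub>1 x) \<and> \<beta>\<^sub>1 (\<gamma>\<^sub>1 x) = f (f x)"
    "\<And>y. y \<in> B\<^sub>1 \<Longrightarrow> \<beta>\<^sub>1 y \<in> A\<^sub>1 \<and> \<beta>\<^sub>1 (g y) = f (\<beta>\<^sub>1 y) \<and> \<gamma>\<^sub>1 (\<beta>\<^sub>1 y) = g (g y)"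
    unfolding linked_def by blast
  from l2 obtain \<gamma>\<^sub>2 \<beta>\<^sub>2 where 2: "endo \<gamma>\<^sub>2" "endo \<beta>\<^sub>2"
    "\<And>x. x \<in> A\<^sub>2 \<Longrightarrow> \<gamma>\<^sub>2 x \<in> B\<^sub>2 \<and> \<gamma>\<^sub>2 (f x) = g (\<gamma>\<^sub>2 x) \<and> \<beta>\<^sub>2 (\<gamma>\<^sub>2 x) = f (f x)"
    "\<And>y. y \<in> B\<^sub>2 \<Longrightarrow> \<beta>\<^sub>2 y \<in> A\<^sub>2 \<and> \<beta>\<^sub>2 (g y) = f (\<beta>\<^sub>2 y) \<and> \<gamma>\<^sub>2 (\<beta>\<^sub>2 y) = g (g y)"
    unfolding linked_def by blast
  obtain \<gamma> where \<gamma>: "endo \<gamma>" "\<And>x. x \<in> A\<^sub>1 \<Longrightarrow> \<gamma> x = \<gamma>\<^sub>1 x" "\<And>x. x \<in> A\<^sub>2 \<Longrightarrow> \<gamma> x = \<gamma>\<^sub>2 x"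
    using endo_direct_sum[OF A(1,2,5) 1(1) 2(1)] by blast
  obtain \<beta> where \<beta>: "endo \<beta>" "\<And>y. y \<in> B\<^sub>1 \<Longrightarrow> \<beta> y = \<beta>\<^sub>1 y" "\<And>y. y \<in> B\<^sub>2 \<Longrightarrow> \<beta> y = \<beta>\<^sub>2 y"
    using endo_direct_sum[OF B(1,2,5) 1(2) 2(2)] by blast
  have inv: "x \<in> A\<^sub>1 \<Longrightarrow> f x \<in> A\<^sub>1" "x \<in> A\<^sub>2 \<Longrightarrow> f x \<in> A\<^sub>2" "x \<in> B\<^sub>1 \<Longrightarrow> g x \<in> B\<^sub>1" "x \<in> B\<^sub>2 \<Longrightarrow> g x \<in> B\<^sub>2" for x
    using A(3,4) B(3,4) by auto
  note s = endo_add[OF \<gamma>(1)] endo_add[OF \<beta>(1)] endo_add[OF f] endo_add[OF g]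
  have "\<gamma> x \<in> B \<and> \<gamma> (f x) = g (\<gamma> x) \<and> \<beta> (\<gamma> x) = f (f x)" if "x \<in> A" for x
  proof -
    from that obtain x\<^sub>1 x\<^sub>2 where x: "x = x\<^sub>1 + x\<^sub>2" "x\<^sub>1 \<in> A\<^sub>1" "x\<^sub>2 \<in> A\<^sub>2" unfolding A(6) by blast
    then have "\<gamma> x = \<gamma>\<^sub>1 x\<^sub>1 + \<gamma>\<^sub>2 x\<^sub>2" by (simp add: s \<gamma>)
    moreover have "\<gamma>\<^sub>1 x\<^sub>1 + \<gamma>\<^sub>2 x\<^sub>2 \<in> B" unfolding B(6) using 1(3)[OF x(2)] 2(3)[OF x(3)] by blast
    ultimately show ?thesis
      using x 1(3)[OF x(2)] 2(3)[OF x(3)] by (simp add: s \<gamma> \<beta> inv)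
  qed
  moreover have "\<beta> x \<in> A \<and> \<beta> (g x) = f (\<beta> x) \<and> \<gamma> (\<beta> x) = g (g x)" if "x \<in> B" for x
  proof -
    from that obtain x\<^sub>1 x\<^sub>2 where x: "x = x\<^sub>1 + x\<^sub>2" "x\<^sub>1 \<in> B\<^sub>1" "x\<^sub>2 \<in> B\<^sub>2" unfolding B(6) by blast
    then have "\<beta> x = \<beta>\<^sub>1 x\<^sub>1 + \<beta>\<^sub>2 x\<^sub>2" by (simp add: s \<beta>)
    moreover have "\<beta>\<^sub>1 x\<^sub>1 + \<beta>\<^sub>2 x\<^sub>2 \<in> A" unfolding A(6) using 1(4)[OF x(2)] 2(4)[OF x(3)] by blast
    ultimately show ?thesis
      using x 1(4)[OF x(2)] 2(4)[OF x(3)] by (simp add: s \<gamma> \<beta> inv)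
  qed
  ultimately show ?thesis
    unfolding linked_def using \<gamma>(1) \<beta>(1) by blast
qed

text \<open>
  The hypotheses \<open>drop\<close> say that the numbers of Jordan blocks of size at least \<open>k\<close> form 2-intertwined
  sequences. Blocks are paired in decreasing order of size: paired sizes differ by at most 2, and
  removing the two largest blocks preserves \<open>drop\<close>.
\<close>

lemma nilpotent_linked:
  assumes f: "endo f" and g: "endo g"
    and "subspace A" "f ` A \<subseteq> A" "(f ^^ n) ` A \<subseteq> {0}"
    and "subspace B" "g ` B \<subseteq> B" "(g ^^ n) ` B \<subseteq> {0}"
    and drop: "\<And>k. dim ((f ^^ (k + 2)) ` A) + dim ((g ^^ (k + 1)) ` B)
        \<le> dim ((g ^^ k) ` B) + dim ((f ^^ (k + 3)) ` A)"
      "\<And>k. dim ((g ^^ (k + 2)) ` B) + dim ((f ^^ (k + 1)) ` A)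
        \<le> dim ((f ^^ k) ` A) + dim ((g ^^ (k + 3)) ` B)"
  shows "linked f A g B"
  using assms(3-)
proof (induction "dim A + dim B" arbitrary: A B rule: less_induct)
  case less
  obtain a e A' where a: "nil_order f e a" "span (chain f e a) \<subseteq> A" "(f ^^ a) ` A \<subseteq> {0}"
    "subspace A'" "f ` A' \<subseteq> A'" "span (chain f e a) \<inter> A' \<subseteq> {0}"
    "A = {x + y |x y. x \<in> span (chain f e a) \<and> y \<in> A'}"
    using nilpotent_split[OF f less.prems(1-3)] .
  obtain b e' B' where b: "nil_order g e' b" "span (chain g e' b) \<subseteq> B" "(g ^^ b) ` B \<subseteq> {0}"
    "subspace B'" "g ` B' \<subseteq> B'" "span (chain g e' b) \<inter> B' \<subseteq> {0}"
    "B = {x + y |x y. x \<in> span (chain g e' b) \<and> y \<in> B'}"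
    using nilpotent_split[OF g less.prems(4-6)] .
  note iC = span_chain_invariant[OF f a(1)] and iC' = span_chain_invariant[OF g b(1)]
  define rA where "rA k = dim ((f ^^ k) ` A')" for k
  define rB where "rB k = dim ((g ^^ k) ` B')" for k
  have dA: "dim ((f ^^ k) ` A) = (a - k) + rA k" for k
    using dim_image_direct_sum[OF f subspace_span a(4) iC a(5,6,7), of k]
      dim_image_span_chain[OF f a(1), of k] unfolding rA_def by linarith
  have dB: "dim ((g ^^ k) ` B) = (b - k) + rB k" for k
    using dim_image_direct_sum[OF g subspace_span b(4) iC' b(5,6,7), of k]
      dim_image_span_chain[OF g b(1), of k] unfolding rB_def by linarith
  have zero: "dim ((f ^^ k) ` S) = 0" if f: "endo f" and "(f ^^ a) ` S \<subseteq> {0}" "a \<le> k" for f S a k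
  proof -
    have "(f ^^ k) x = 0" if "x \<in> S" for x
    proof -
      have "(f ^^ k) x = (f ^^ (k - a)) ((f ^^ a) x)"
        using \<open>a \<le> k\<close> by (metis comp_apply funpow_add le_add_diff_inverse2)
      then show ?thesis using \<open>(f ^^ a) ` S \<subseteq> {0}\<close> that endo_zero[OF endo_pow[OF f]] by auto
    qed
    then show ?thesis by auto
  qed
  have mono: "dim ((f ^^ Suc k) ` S) \<le> dim ((f ^^ k) ` S)" if "f ` S \<subseteq> S" for f S k
    using that by (intro dim_subset) (auto simp: funpow_swap1)
  have A'A: "A' \<subseteq> A" and B'B: "B' \<subseteq> B"
    unfolding a(7) b(7) using span_zero by force+
  have zA: "rA k = 0" if "a \<le> k" for k
    unfolding rA_def using zero[OF f _ that, of A'] a(3) A'A by blast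
  have zB: "rB k = 0" if "b \<le> k" for k
    unfolding rB_def using zero[OF g _ that, of B'] b(3) B'B by blast
  have mA: "rA (Suc k) \<le> rA k" for k unfolding rA_def by (rule mono[OF a(5)])
  have mB: "rB (Suc k) \<le> rB k" for k unfolding rB_def by (rule mono[OF b(5)])
  have eqs: "k + 2 = Suc (Suc k)" "k + 3 = Suc (Suc (Suc k))" "k + 1 = Suc k" for k :: nat
    by simp_all
  note drop = less.prems(7-8)[unfolded dA dB eqs]
  \<comment> \<open>At k = b the ranks on B vanish, so the first hypothesis forbids a drop of rank
    between f^(b + 2) A and f^(b + 3) A; a chain longer than b + 2 would cause one.\<close>
  have ab: "a \<le> b + 2"
  proof (rule ccontr)
    assume "\<not> a \<le> b + 2"
    then show False
      using drop(1)[of b] zB[of b] zB[of "Suc b"] mA[of "Suc (Suc b)"] by linarith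
  qed
  have ba: "b \<le> a + 2"
  proof (rule ccontr)
    assume "\<not> b \<le> a + 2"
    then show False
      using drop(2)[of a] zA[of a] zA[of "Suc a"] mB[of "Suc (Suc a)"] by linarith
  qed
  show ?case
  proof (cases "a = 0 \<and> b = 0")
    case True
    then have "A \<subseteq> {0}" "B \<subseteq> {0}" using a(3) b(3) by auto
    moreover have "endo (\<lambda>x. 0)" by (simp add: endo_iff)
    ultimately show ?thesis
      unfolding linked_def using less.prems(1,4) subspace_0 endo_zero[OF f] endo_zero[OF g]
      by (intro exI[of _ "\<lambda>x. 0"]) auto
  next
    case False
    have "linked f A' g B'"
    proof (rule less.hyps)
      show "dim A' + dim B' < dim A + dim B"
        using False dA[of 0] dB[of 0] by (auto simp: rA_def rB_def)
      show "(f ^^ n) ` A' \<subseteq> {0}" "(g ^^ n) ` B' \<subseteq> {0}"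
        using A'A B'B less.prems(3,6) by blast+
      fix k
      show "dim ((f ^^ (k + 2)) ` A') + dim ((g ^^ (k + 1)) ` B')
          \<le> dim ((g ^^ k) ` B') + dim ((f ^^ (k + 3)) ` A')"
        \<comment> \<open>If k + 2 < a, then k < b by \<open>ab\<close>, and the two chains
          contribute an excess of 1 to opposite sides, which cancels. Otherwise the ranks on A' are
          0 and monotonicity on B' suffices. The second inequality is symmetric.\<close>
        unfolding rA_def[symmetric] rB_def[symmetric] eqs
        using drop(1)[of k] zA[of "Suc (Suc k)"] mB[of k] ab by linarith
      show "dim ((g ^^ (k + 2)) ` B') + dim ((f ^^ (k + 1)) ` A')
          \<le> dim ((f ^^ k) ` A') + dim ((g ^^ (k + 3)) ` B')"
        unfolding rA_def[symmetric] rB_def[symmetric] eqs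
        using drop(2)[of k] zB[of "Suc (Suc k)"] mA[of k] ba by linarith
    qed fact+
    moreover have "linked f (span (chain f e a)) g (span (chain g e' b))"
    proof (cases "b \<le> a")
      case True
      then show ?thesis using linked_chain[OF f g a(1) b(1)] ab by blast
    next
      case False
      then show ?thesis using linked_sym[OF linked_chain[OF g f b(1) a(1)]] ba by simp
    qed
    ultimately show ?thesis
      using linked_direct_sum[OF f g subspace_span a(4) iC a(5-7) subspace_span b(4) iC' b(5-7)] by blast
  qed
qed

end

section \<open>Sufficiency of the intertwining condition\<close>

lemma (in finite_dimensional_vector_space) funpow_neg:
  assumes "endo f"
  shows "((\<lambda>x. - f x) ^^ k) x = (f ^^ k) x \<or> ((\<lambda>x. - f x) ^^ k) x = - (f ^^ k) x"
  by (induction k) (auto simp: endo_neg[OF assms])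

lemma (in finite_dimensional_vector_space) funpow_neg_image:
  assumes f: "endo f" and S: "subspace S"
  shows "((\<lambda>x. - f x) ^^ k) ` S = (f ^^ k) ` S"
proof -
  have *: "((\<lambda>x. - g x) ^^ k) ` S \<subseteq> (g ^^ k) ` S" if g: "endo g" for g
  proof clarify
    fix x assume "x \<in> S"
    then show "((\<lambda>x. - g x) ^^ k) x \<in> (g ^^ k) ` S"
      using funpow_neg[OF g, of k x]
        subspace_neg[OF subspace_image_endo[OF endo_pow[OF g] S], of "(g ^^ k) x" k] by auto
  qed
  have "endo (\<lambda>x. - f x)" using f by (auto simp: endo_iff)
  from *[OF f] *[OF this] show ?thesis by simp
qed

text \<open>The consequence of exceptionality that sufficiency works with. A single exponent for
  both factors keeps the assumptions symmetric under exchange of a and b.\<close>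

locale two_eigenvalues = finite_dimensional_vector_space +
  fixes u :: "'b \<Rightarrow> 'b" and a b :: 'a and n :: nat
  assumes u: "endo u" and ab: "a \<noteq> b"
    and nilpotent: "\<And>x. ((\<lambda>y. u y - scale a y) ^^ n) (((\<lambda>y. u y - scale b y) ^^ n) x) = 0"
begin

abbreviation "w c \<equiv> \<lambda>x. u x - scale c x"

lemmas us = endo_simps[OF u]

lemma endo_w: "endo (w c)"
  by (intro endo_shift u)

lemma w_comm: "w c (w d x) = w d (w c x)"
  by (simp add: us algebra_simps)

lemma nilpotent': "(w b ^^ n) ((w a ^^ n) x) = 0"
proof -
  have "(w a ^^ n) (w b y) = w b ((w a ^^ n) y)" for y
    by (rule funpow_commute[of "w a" "w b", OF w_comm[where c = a and d = b]])
  then show ?thesis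
    using nilpotent[of x] funpow_commute[of "w b" "w a ^^ n" n x] by simp
qed

abbreviation "V\<^sub>a \<equiv> ker (w a ^^ n)"

lemma subspace_Va: "subspace V\<^sub>a"
  by (intro subspace_ker endo_pow endo_w)

text \<open>(u - a)^n maps into Ker (u - b)^n, which meets each Ker (u - a)^k only in 0. Hence
  \<open>V\<^sub>a\<close> is the full generalized eigenspace.\<close>

lemma ker_subset_Va: "ker (w a ^^ k) \<subseteq> V\<^sub>a"
proof clarify
  fix x assume x: "(w a ^^ k) x = 0"
  show "(w a ^^ n) x = 0"
  proof (rule coprime_kernels[OF endo_w endo_w, of b a "a - b" k _ n])
    show "(w a ^^ k) ((w a ^^ n) x) = 0"
      unfolding funpow_swap[of k _ n] x by (rule endo_zero[OF endo_pow[OF endo_w]])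
    show "(w b ^^ n) ((w a ^^ n) x) = 0" by (rule nilpotent')
  qed (use ab in \<open>simp_all add: scale_left_diff_distrib\<close>)
qed

lemma w_Va: "w c ` V\<^sub>a \<subseteq> V\<^sub>a"
proof clarify
  fix x assume "(w a ^^ n) x = 0"
  then show "(w a ^^ n) (w c x) = 0"
    by (simp only: funpow_commute[of "w a" "w c", OF w_comm[where c = a and d = c]] endo_zero[OF endo_w])
qed

lemma jordan_count_eq:
  "jordan_count scale u a (Suc k) = dim ((w a ^^ k) ` V\<^sub>a) - dim ((w a ^^ Suc k) ` V\<^sub>a)"
proof -
  have "dim V\<^sub>a = dim ((w a ^^ i) ` V\<^sub>a) + dim (ker (w a ^^ i))" for i
    using rank_nullity_on[OF endo_pow[OF endo_w] subspace_Va, of i a] ker_subset_Va[of i]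
    by (simp only: Int_absorb1)
  from this[of k] this[of "Suc k"] show ?thesis
    unfolding jordan_count_def ker_pow_def diff_Suc_1 by linarith
qed

lemma rank_mono: "dim ((w a ^^ Suc k) ` V\<^sub>a) \<le> dim ((w a ^^ k) ` V\<^sub>a)"
  using w_Va[of a] by (intro dim_subset) (auto simp only: funpow_Suc_right o_apply intro!: imageI)

end

sublocale two_eigenvalues \<subseteq> swap: two_eigenvalues scale Basis u b a n
  by (intro two_eigenvalues.intro finite_dimensional_vector_space_axioms
      two_eigenvalues_axioms.intro u ab[symmetric] nilpotent')

context two_eigenvalues
begin

abbreviation "V\<^sub>b \<equiv> swap.V\<^sub>a"

lemma Va_Int_Vb: "V\<^sub>a \<inter> V\<^sub>b \<subseteq> {0}"
  using coprime_kernels[OF endo_w endo_w, of b a "a - b" n _ n] ab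
  by (auto simp: scale_left_diff_distrib)

text \<open>By dimension: (u - b)^n (u - a)^n = 0 has the whole space as kernel, so the two kernels,
  which meet in 0, have dimensions adding up to at least that of the space.\<close>

lemma decompose: obtains y z where "x = y + z" "y \<in> V\<^sub>a" "z \<in> V\<^sub>b"
proof -
  let ?S = "{y + z |y z. y \<in> V\<^sub>a \<and> z \<in> V\<^sub>b}"
  have "dim UNIV \<le> dim V\<^sub>b + dim V\<^sub>a"
    using dim_ker_comp_le[OF endo_pow[OF endo_w] endo_pow[OF endo_w], of n b n a] by (simp add: nilpotent')
  also have "\<dots> = dim ?S"
    using dim_direct_sum[OF subspace_Va swap.subspace_Va Va_Int_Vb refl] by simp
  finally have "?S = UNIV"
    using subspace_dim_equal[of ?S UNIV] subspace_sums[OF subspace_Va swap.subspace_Va] subspace_UNIV by auto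
  then show thesis using that by blast
qed

lemma linked_if_intertwined:
  assumes "intertwined 2 (jordan_count scale u a) (jordan_count scale u b)"
  shows "linked (w a) V\<^sub>a (\<lambda>x. - w b x) V\<^sub>b"
proof -
  let ?g = "\<lambda>x. - w b x"
  have g: "endo ?g" by (auto simp: endo_iff us algebra_simps)
  have img: "(?g ^^ k) ` V\<^sub>b = (w b ^^ k) ` V\<^sub>b" for k
    by (rule funpow_neg_image[OF endo_w swap.subspace_Va])
  have drop: "dim ((w a ^^ (k + 2)) ` V\<^sub>a) + dim ((w b ^^ (k + 1)) ` V\<^sub>b)
        \<le> dim ((w b ^^ k) ` V\<^sub>b) + dim ((w a ^^ (k + 3)) ` V\<^sub>a)"
     "dim ((w b ^^ (k + 2)) ` V\<^sub>b) + dim ((w a ^^ (k + 1)) ` V\<^sub>a)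
        \<le> dim ((w a ^^ k) ` V\<^sub>a) + dim ((w b ^^ (k + 3)) ` V\<^sub>b)" for k
  proof -
    have eqs: "k + 2 = Suc (Suc k)" "k + 3 = Suc (Suc (Suc k))" "k + 1 = Suc k" "Suc k + 2 = Suc (Suc (Suc k))"
      by simp_all
    have "jordan_count scale u a (Suc k + 2) \<le> jordan_count scale u b (Suc k)"
      "jordan_count scale u b (Suc k + 2) \<le> jordan_count scale u a (Suc k)"
      using assms by (auto simp only: intertwined_def One_nat_def intro!: Suc_le_mono[THEN iffD2])
    \<comment> \<open>Monotonicity of the ranks makes the truncated differences genuine, so the
      inequalities can be rearranged additively.\<close>
    note this[unfolded eqs jordan_count_eq swap.jordan_count_eq]
      rank_mono[of k] rank_mono[of "Suc k"] rank_mono[of "Suc (Suc k)"]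
      swap.rank_mono[of k] swap.rank_mono[of "Suc k"] swap.rank_mono[of "Suc (Suc k)"]
    then show "dim ((w a ^^ (k + 2)) ` V\<^sub>a) + dim ((w b ^^ (k + 1)) ` V\<^sub>b)
        \<le> dim ((w b ^^ k) ` V\<^sub>b) + dim ((w a ^^ (k + 3)) ` V\<^sub>a)"
     "dim ((w b ^^ (k + 2)) ` V\<^sub>b) + dim ((w a ^^ (k + 1)) ` V\<^sub>a)
        \<le> dim ((w a ^^ k) ` V\<^sub>a) + dim ((w b ^^ (k + 3)) ` V\<^sub>b)"
      unfolding eqs by linarith+
  qed
  show ?thesis
  proof (rule nilpotent_linked[OF endo_w g, where n = n])
    show "subspace V\<^sub>a" "subspace V\<^sub>b" by (rule subspace_Va swap.subspace_Va)+
    show "w a ` V\<^sub>a \<subseteq> V\<^sub>a" by (rule w_Va)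
    show "?g ` V\<^sub>b \<subseteq> V\<^sub>b" using swap.w_Va[of b] subspace_neg[OF swap.subspace_Va] by blast
    show "(w a ^^ n) ` V\<^sub>a \<subseteq> {0}" by auto
    show "(?g ^^ n) ` V\<^sub>b \<subseteq> {0}" unfolding img by auto
  qed (unfold img, (rule drop)+)
qed

end

lemma (in finite_dimensional_vector_space) funpow_scale:
  assumes "endo g"
  shows "((\<lambda>x. scale c (g x)) ^^ k) x = scale (c ^ k) ((g ^^ k) x)"
  by (induction k) (simp_all add: endo_scale[OF assms])

context two_eigenvalues
begin

interpretation vp: finite_dimensional_vector_space_pair scale Basis scale Basis
  by unfold_locales

text \<open>With h = 2 u - a - b, the square of h is 4 (u - a) (u - b) + (a - b)^2, a nilpotent map
  plus a nonzero scalar. So h is injective, also in characteristic 2, where it is itself a nonzero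
  scalar.\<close>

lemma ex_inverse_2u_minus_trace:
  obtains s where "endo s" "\<And>x. s (w a x + w b x) = x" "\<And>x. w a (s x) + w b (s x) = x"
proof -
  let ?h = "\<lambda>x. w a x + w b x" and ?f = "\<lambda>x. scale 4 (w a (w b x))"
  have h: "endo ?h" by (auto simp: endo_iff us algebra_simps)
  have f: "endo ?f" by (auto simp: endo_iff us algebra_simps)
  have "(?f ^^ k) x = scale (4 ^ k) (((\<lambda>x. w a (w b x)) ^^ k) x)" for k x
    by (rule funpow_scale) (auto simp: endo_iff us algebra_simps)
  moreover have "((\<lambda>x. w a (w b x)) ^^ n) x = 0" for x
    unfolding funpow_comp_commute[of "w a" "w b", OF w_comm[where c = a and d = b]] by (rule nilpotent)
  ultimately have f_nil: "(?f ^^ n) x = 0" for x by simp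
  have "x = 0" if "?h x = 0" for x
  proof (rule coprime_kernels[OF f endo_comp[OF h h], of "(a - b) * (a - b)" n _ 1])
    have "4 = (1 + 1 + 1 + 1 :: 'a)" by simp
    then have 4: "scale 4 y = y + y + y + y" for y
      by (simp only: scale_left_distrib scale_one)
    have "(a - b) * (a - b) = a * a - a * b - a * b + b * b"
      by (simp add: algebra_simps)
    then have sq: "scale ((a - b) * (a - b)) y = scale (a * a) y - scale (a * b) y - scale (a * b) y + scale (b * b) y" for y
      by (simp only: scale_left_distrib scale_left_diff_distrib)
    show "?h (?h y) = ?f y + scale ((a - b) * (a - b)) y" for y
      unfolding 4 sq by (simp add: us scale_right_diff_distrib scale_right_distrib mult.commute)
    show "((\<lambda>x. ?h (?h x)) ^^ 1) x = 0" using that endo_zero[OF h] by simp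
  qed (use ab f_nil in auto)
  then have "inj ?h" using vp.linear_inj_iff_eq_0[OF h] by blast
  from vp.linear_injective_isomorphism[OF h this] that show thesis by auto
qed

text \<open>
  The solution is \<open>N = - (u - a) (u - b) (2 u - a - b)\<^sup>-\<^sup>1 + G\<close>, where \<open>G\<close> exchanges the two generalized
  eigenspaces and satisfies \<open>u G + G u = (a + b) G\<close>.
\<close>

theorem difference_if_intertwined:
  assumes "intertwined 2 (jordan_count scale u a) (jordan_count scale u b)"
  shows "\<exists>D N. endo D \<and> endo N \<and> (\<forall>x. N (N x) = 0) \<and>
    (\<forall>x. D (D x) = scale (a + b) (D x) - scale (a * b) x) \<and> (\<forall>x. u x = D x - N x)"
proof -
  define P Q where "P = w a" and "Q = w b"
  have PQ_endo: "endo P" "endo Q" unfolding P_def Q_def by (rule endo_w)+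
  have QP: "Q (P x) = P (Q x)" for x unfolding P_def Q_def by (rule w_comm)
  have Pu: "P (u x) = u (P x)" and Qu: "Q (u x) = u (Q x)" for x
    by (simp_all add: P_def Q_def us)
  obtain s where s: "endo s" "\<And>x. s (P x + Q x) = x" "\<And>x. P (s x) + Q (s x) = x"
    using ex_inverse_2u_minus_trace unfolding P_def Q_def by blast
  have us_comm: "u (s x) = s (u x)" for x
  proof -
    have "P (u (s x)) + Q (u (s x)) = u x"
      unfolding Pu Qu endo_add[OF u, symmetric] s(3) ..
    then show ?thesis using s(2)[of "u (s x)"] by simp
  qed
  have Ps: "P (s x) = s (P x)" and Qs: "Q (s x) = s (Q x)" for x
    by (simp_all add: P_def Q_def us_comm endo_simps[OF s(1)])
  have Va: "P x \<in> V\<^sub>a" "Q x \<in> V\<^sub>a" "s x \<in> V\<^sub>a" "u x \<in> V\<^sub>a" if x: "x \<in> V\<^sub>a" for x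
  proof -
    show PQ: "P x \<in> V\<^sub>a" "Q x \<in> V\<^sub>a" using w_Va x unfolding P_def Q_def by blast+
    have "(P ^^ n) (s x) = s ((P ^^ n) x)" by (rule funpow_commute[of P s, OF Ps])
    then show "s x \<in> V\<^sub>a" using x by (simp add: P_def[symmetric] endo_zero[OF s(1)])
    have "w a x + scale a x \<in> V\<^sub>a"
      using PQ(1) x unfolding P_def by (intro subspace_add[OF subspace_Va] subspace_scale[OF subspace_Va])
    then show "u x \<in> V\<^sub>a" by (simp only: diff_add_cancel)
  qed
  have Vb: "u x \<in> V\<^sub>b" if x: "x \<in> V\<^sub>b" for x
  proof -
    have "w b x \<in> V\<^sub>b" using swap.w_Va x by blast
    then have "w b x + scale b x \<in> V\<^sub>b"
      using x by (intro subspace_add[OF swap.subspace_Va] subspace_scale[OF swap.subspace_Va])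
    then show ?thesis by (simp only: diff_add_cancel)
  qed
  have "linked P V\<^sub>a (\<lambda>x. - Q x) V\<^sub>b"
    unfolding P_def Q_def by (rule linked_if_intertwined[OF assms])
  then obtain \<gamma> \<beta> where \<gamma>: "endo \<gamma>" and \<beta>: "endo \<beta>"
    and \<gamma>_Va: "\<And>x. x \<in> V\<^sub>a \<Longrightarrow> \<gamma> x \<in> V\<^sub>b \<and> \<gamma> (P x) = - Q (\<gamma> x) \<and> \<beta> (\<gamma> x) = P (P x)"
    and \<beta>_Vb: "\<And>y. y \<in> V\<^sub>b \<Longrightarrow> \<beta> y \<in> V\<^sub>a \<and> \<beta> (- Q y) = P (\<beta> y) \<and> \<gamma> (\<beta> y) = - Q (- Q y)"
    unfolding linked_def by blast
  have u\<gamma>: "u (\<gamma> x) = scale (a + b) (\<gamma> x) - \<gamma> (u x)" if "x \<in> V\<^sub>a" for x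
    using \<gamma>_Va[OF that] by (simp add: P_def Q_def endo_simps[OF \<gamma>] algebra_simps)
  have u\<beta>: "u (\<beta> y) = scale (a + b) (\<beta> y) - \<beta> (u y)" if "y \<in> V\<^sub>b" for y
    using \<beta>_Vb[OF that] by (simp add: P_def Q_def endo_simps[OF \<beta>] algebra_simps)
  have \<gamma>Q: "\<gamma> (Q x) = - P (\<gamma> x)" if "x \<in> V\<^sub>a" for x
    using u\<gamma>[OF that] by (simp add: P_def Q_def endo_simps[OF \<gamma>] algebra_simps)
  \<comment> \<open>On \<open>V\<^sub>a\<close> the map \<gamma> anticommutes with P + Q, hence with
    its inverse s.\<close>
  have \<gamma>s: "\<gamma> (s x) = - s (\<gamma> x)" if "x \<in> V\<^sub>a" for x
  proof -
    note x = Va(3)[OF that]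
    have "\<gamma> x = \<gamma> (P (s x) + Q (s x))" unfolding s(3) ..
    also have "\<dots> = - (P (\<gamma> (s x)) + Q (\<gamma> (s x)))"
      using \<gamma>_Va[OF x] \<gamma>Q[OF x] by (simp add: endo_add[OF \<gamma>])
    finally show ?thesis by (simp only: endo_neg[OF s(1)] s(2) minus_minus)
  qed
  \<comment> \<open>The rescaling unit. On \<open>V\<^sub>a\<close> the composite \<beta> \<gamma>
    is P^2, and G^2 has to be - (P Q)^2 s^2 there, so the factor - Q^2 s^2 is supplied. The order Q,
    s, Q, s suits the sign bookkeeping below.\<close>
  define F where "F x = - Q (s (Q (s x)))" for x
  note QP_simps = endo_simps[OF PQ_endo(1)] endo_simps[OF PQ_endo(2)] endo_simps[OF s(1)]
  have F: "endo F" by (auto simp: endo_iff F_def QP_simps)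
  have uF: "u (F x) = F (u x)" for x
    by (simp add: F_def Qu[symmetric] us_comm endo_neg[OF u])
  obtain G where G: "endo G" "\<And>x. x \<in> V\<^sub>a \<Longrightarrow> G x = \<gamma> x" "\<And>x. x \<in> V\<^sub>b \<Longrightarrow> G x = F (\<beta> x)"
    using endo_direct_sum[OF subspace_Va swap.subspace_Va Va_Int_Vb \<gamma> endo_comp[OF F \<beta>]] by blast
  note Gs = endo_simps[OF G(1)]
  have uG: "u (G x) = scale (a + b) (G x) - G (u x)" for x
  proof -
    obtain y z where x: "x = y + z" "y \<in> V\<^sub>a" "z \<in> V\<^sub>b" by (rule decompose)
    have "u (G y) = scale (a + b) (G y) - G (u y)"
      using x(2) Va(4) by (simp add: G(2) u\<gamma>)
    moreover have "u (G z) = scale (a + b) (G z) - G (u z)"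
      using x(3) Vb by (simp add: G(3) uF u\<beta> endo_simps[OF F])
    ultimately show ?thesis unfolding x(1) by (simp add: Gs us algebra_simps)
  qed
  define z where "z x = P (Q x)" for x
  have z: "endo z" by (auto simp: endo_iff z_def QP_simps)
  have GG: "G (G x) = - z (z (s (s x)))" for x
  proof -
    obtain y t where x: "x = y + t" "y \<in> V\<^sub>a" "t \<in> V\<^sub>b" by (rule decompose)
    have "G (G y) = - z (z (s (s y)))"
      using x(2) \<gamma>_Va by (simp add: G F_def z_def Ps Qs QP)
    moreover have "G (G t) = - z (z (s (s t)))"
    proof -
      let ?y = "\<beta> t"
      have y: "?y \<in> V\<^sub>a" "\<gamma> ?y = Q (Q t)" using \<beta>_Vb[OF x(3)] by (simp_all add: QP_simps)
      have "F ?y \<in> V\<^sub>a" unfolding F_def by (intro subspace_neg[OF subspace_Va] Va y)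
      then have "G (G t) = - \<gamma> (Q (s (Q (s ?y))))"
        using x(3) by (simp add: G F_def endo_simps[OF \<gamma>])
      \<comment> \<open>\<gamma> passes Q, s, Q, s in turn, each at the cost of a sign, and turns Q
        into P. The four signs cancel.\<close>
      also have "\<dots> = - P (s (P (s (\<gamma> ?y))))"
        using Va y(1) by (simp add: \<gamma>Q \<gamma>s QP_simps)
      finally show ?thesis unfolding y(2) by (simp add: z_def Ps Qs QP)
    qed
    ultimately show ?thesis unfolding x(1)
      by (simp add: Gs endo_simps[OF z] endo_simps[OF s(1)])
  qed
  have PG: "P (G x) = - G (Q x)" and QG: "Q (G x) = - G (P x)" for x
    by (simp_all add: P_def Q_def uG Gs algebra_simps)
  have zG: "z (G x) = G (z x)" for x
    by (simp add: z_def PG QG QP_simps Gs QP)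
  have sG: "s (G x) = - G (s x)" for x
  proof -
    have "G x = G (P (s x) + Q (s x))" unfolding s(3) ..
    also have "\<dots> = P (- G (s x)) + Q (- G (s x))" by (simp add: PG QG QP_simps Gs)
    finally show ?thesis by (simp only: s(2))
  qed
  have zs: "z (s x) = s (z x)" and zu: "z (u x) = u (z x)" for x
    by (simp_all add: z_def Ps Qs Pu Qu)
  define N where "N x = G x - z (s x)" for x
  define D where "D x = u x + N x" for x
  have N: "endo N" by (auto simp: endo_iff N_def Gs endo_simps[OF z] endo_simps[OF s(1)] algebra_simps)
  have D: "endo D" by (auto simp: endo_iff D_def us endo_simps[OF N] algebra_simps)
  \<comment> \<open>G^2 cancels (z s)^2, and the mixed terms cancel because G commutes with z and
    anticommutes with s.\<close>
  have NN: "N (N x) = 0" for x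
    by (simp add: N_def Gs endo_simps[OF z] endo_simps[OF s(1)] GG zs zG sG)
  have DD: "D (D x) = scale (a + b) (D x) - scale (a * b) x" for x
  proof -
    \<comment> \<open>Since s inverts 2 u - a - b, multiplying by z s gives 2 z s u = z + (a + b) z
      s. The left side occurs in u N + N u, where G contributes only (a + b) G.\<close>
    have "z x = z (P (s x) + Q (s x))" unfolding s(3) ..
    then have key: "z (s (u x)) + z (s (u x)) = z x + scale (a + b) (z (s x))"
      by (simp add: P_def Q_def us_comm endo_simps[OF z] algebra_simps)
    have "D (D x) = u (u x) + (u (N x) + N (u x))"
      by (simp add: D_def us endo_simps[OF N] NN)
    also have "u (N x) + N (u x) = scale (a + b) (G x) - (z (s (u x)) + z (s (u x)))"
      by (simp add: N_def us uG zu[symmetric] us_comm)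
    finally have "D (D x) = u (u x) + scale (a + b) (G x) - (z x + scale (a + b) (z (s x)))"
      unfolding key by (simp add: algebra_simps)
    moreover have "z x = u (u x) - scale (a + b) (u x) + scale (a * b) x"
      by (simp add: z_def P_def Q_def us algebra_simps)
    ultimately show ?thesis by (simp add: D_def N_def algebra_simps)
  qed
  show ?thesis
    using D N NN DD by (intro exI[of _ D] exI[of _ N]) (simp add: D_def)
qed

end

section \<open>Annihilating polynomials\<close>

context vector_space
begin

lemma poly_endo_eq_sum:
  assumes "degree r \<le> n"
  shows "poly_endo scale r f x = (\<Sum>i\<le>n. scale (coeff r i) ((f ^^ i) x))"
  unfolding poly_endo_def using assms
  by (intro sum.mono_neutral_left) (auto simp: coeff_eq_0 not_le)

lemma poly_endo_add: "poly_endo scale (r + s) f x = poly_endo scale r f x + poly_endo scale s f x"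
proof -
  let ?n = "max (degree r) (degree s)"
  have "degree (r + s) \<le> ?n" by (rule degree_add_le_max)
  then show ?thesis
    by (simp add: poly_endo_eq_sum[of _ ?n] scale_left_distrib sum.distrib)
qed

lemma poly_endo_sum: "poly_endo scale (\<Sum>i\<in>I. r i) f x = (\<Sum>i\<in>I. poly_endo scale (r i) f x)"
proof (induction I rule: infinite_finite_induct)
  case (insert i I)
  then show ?case by (simp add: poly_endo_add)
qed (simp_all add: poly_endo_def)

lemma poly_endo_smult: "poly_endo scale (smult c r) f x = scale c (poly_endo scale r f x)"
  using degree_smult_le[of c r]
  by (simp add: poly_endo_eq_sum[of "smult c r" "degree r"] poly_endo_eq_sum[of r "degree r"] scale_sum_right)

context
  fixes f :: "'b \<Rightarrow> 'b"
  assumes f: "Vector_Spaces.linear scale scale f"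
begin

interpretation f: Vector_Spaces.linear scale scale f by (fact f)

lemma poly_endo_pCons: "poly_endo scale (pCons c r) f x = scale c x + f (poly_endo scale r f x)"
proof -
  have "degree (pCons c r) \<le> Suc (degree r)" by (simp add: degree_pCons_le)
  then show ?thesis
    by (simp add: poly_endo_eq_sum[of "pCons c r" "Suc (degree r)"] poly_endo_eq_sum[of r "degree r"]
        sum.atMost_Suc_shift f.sum f.scale del: sum.atMost_Suc)
qed

lemma poly_endo_0: "poly_endo scale 0 f x = 0"
  by (simp add: poly_endo_def)

lemma linear_poly_endo: "Vector_Spaces.linear scale scale (poly_endo scale r f)"
proof (induction r)
  case 0
  show ?case using vector_space_axioms by (auto simp: poly_endo_0 Vector_Spaces.linear_iff)
next
  case (pCons c r)
  then show ?case using vector_space_axioms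
    by (auto simp: poly_endo_pCons Vector_Spaces.linear_iff f.add f.scale algebra_simps)
qed

lemma poly_endo_mult: "poly_endo scale (r * s) f x = poly_endo scale r f (poly_endo scale s f x)"
proof (induction r)
  case 0
  show ?case by (simp add: poly_endo_0)
next
  case (pCons c r)
  then show ?case
    by (simp add: poly_endo_add poly_endo_smult poly_endo_pCons)
qed

lemma poly_endo_linear_power: "poly_endo scale ([:- c, 1:] ^ k) f x = ((\<lambda>y. f y - scale c y) ^^ k) x"
proof (induction k arbitrary: x)
  case 0
  show ?case by (simp add: poly_endo_def)
next
  case (Suc k)
  then show ?case
    by (simp add: poly_endo_mult poly_endo_pCons poly_endo_0 f.zero del: mult_pCons_left)
qed

text \<open>
  The columns of \<^term>\<open>char_poly_matrix M\<close> are relations between the basis vectors over the ring of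
  polynomials acting through \<^term>\<open>f\<close>; multiplication by the adjugate gives \<open>det\<close> times each vector.
\<close>

lemma poly_endo_char_poly:
  assumes bs: "ordered_basis scale bs"
  shows "poly_endo scale (char_poly (endo_mat scale bs f)) f x = 0"
proof -
  define n M where "n = length bs" and "M = endo_mat scale bs f"
  define P where "P = char_poly_matrix M"
  have dist: "distinct bs" and ind: "independent (set bs)" and sp: "span (set bs) = UNIV"
    using bs by (auto simp: ordered_basis_def)
  have M: "M \<in> carrier_mat n n" by (simp add: M_def n_def endo_mat_def)
  then have P: "P \<in> carrier_mat n n" by (simp add: P_def)
  note adj = adj_mat[OF P]
  have P_idx: "P $$ (i, j) = (if i = j then [:0, 1:] else 0) + [:- M $$ (i, j):]" if "i < n" "j < n" for i j
    using M that by (simp add: P_def char_poly_matrix_def)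
  have f_bs: "f (bs ! j) = (\<Sum>i<n. scale (M $$ (i, j)) (bs ! i))" if "j < n" for j
  proof -
    have "f (bs ! j) = (\<Sum>b\<in>set bs. scale (representation (set bs) (f (bs ! j)) b) b)"
      by (rule sum_representation_eq[symmetric]) (auto simp: ind sp)
    also have "\<dots> = (\<Sum>i<n. scale (representation (set bs) (f (bs ! j)) (bs ! i)) (bs ! i))"
      using bij_betw_nth[OF dist, of "{..<n}" "set bs"] by (intro sum.reindex_bij_betw[symmetric]) (simp add: n_def)
    also have "\<dots> = (\<Sum>i<n. scale (M $$ (i, j)) (bs ! i))"
      using that by (simp add: M_def endo_mat_def n_def)
    finally show ?thesis .
  qed
  have rel: "(\<Sum>i<n. poly_endo scale (P $$ (i, j)) f (bs ! i)) = 0" if "j < n" for j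
  proof -
    have "(\<Sum>i<n. poly_endo scale (P $$ (i, j)) f (bs ! i))
        = (\<Sum>i<n. (if i = j then f (bs ! i) else 0) - scale (M $$ (i, j)) (bs ! i))"
      using that by (intro sum.cong) (auto simp: P_idx poly_endo_add poly_endo_pCons poly_endo_0 f.zero)
    then show ?thesis using that f_bs[OF that] by (simp add: sum_subtractf)
  qed
  have "poly_endo scale (char_poly M) f (bs ! k) = 0" if k: "k < n" for k
  proof -
    let ?Q = "adj_mat P"
    have "0 = (\<Sum>j<n. poly_endo scale (?Q $$ (j, k)) f (\<Sum>i<n. poly_endo scale (P $$ (i, j)) f (bs ! i)))"
      using module_hom.zero[OF linear_poly_endo[unfolded module_hom_iff_linear[symmetric]]] by (simp add: rel)
    also have "\<dots> = (\<Sum>j<n. \<Sum>i<n. poly_endo scale (?Q $$ (j, k) * P $$ (i, j)) f (bs ! i))"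
      by (simp add: poly_endo_mult module_hom.sum[OF linear_poly_endo[unfolded module_hom_iff_linear[symmetric]]])
    also have "\<dots> = (\<Sum>i<n. poly_endo scale (\<Sum>j<n. P $$ (i, j) * ?Q $$ (j, k)) f (bs ! i))"
      by (subst sum.swap) (simp add: poly_endo_sum mult.commute)
    also have "\<dots> = (\<Sum>i<n. if i = k then poly_endo scale (det P) f (bs ! i) else 0)"
    proof (intro sum.cong refl)
      fix i assume "i \<in> {..<n}"
      then have "(\<Sum>j<n. P $$ (i, j) * ?Q $$ (j, k)) = (P * ?Q) $$ (i, k)"
        using P adj(1) k by (auto simp: scalar_prod_def atLeast0LessThan)
      also have "\<dots> = (if i = k then det P else 0)"
        unfolding adj(2) using \<open>i \<in> {..<n}\<close> k by auto
      finally show "poly_endo scale (\<Sum>j<n. P $$ (i, j) * ?Q $$ (j, k)) f (bs ! i)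
          = (if i = k then poly_endo scale (det P) f (bs ! i) else 0)"
        by (simp add: poly_endo_0)
    qed
    also have "\<dots> = poly_endo scale (char_poly M) f (bs ! k)"
      using k by (simp add: char_poly_def P_def)
    finally show ?thesis by simp
  qed
  then have "\<forall>b\<in>set bs. poly_endo scale (char_poly M) f b = 0"
    by (metis in_set_conv_nth n_def)
  then show ?thesis
    using module_hom.eq_0_on_span[OF linear_poly_endo[unfolded module_hom_iff_linear[symmetric]], of "set bs"] sp
    by (simp add: M_def)
qed

end

end

text \<open>Divide out the full powers of t - a and t - b. A root of the remaining factor in the
  closure would be an eigenvalue, hence a or b, contrary to the choice of the powers; so this factor
  is constant, and monic.\<close>

lemma char_poly_eq_linear_powers:
  fixes M :: "'a::field mat"
  assumes M: "M \<in> carrier_mat n n" and ab: "a \<noteq> b"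
    and ev: "\<And>\<mu>. eigenvalue (map_mat to_ac M) \<mu> \<Longrightarrow> \<mu> \<in> {to_ac a, to_ac b}"
  obtains i j where "char_poly M = [:- a, 1:] ^ i * [:- b, 1:] ^ j"
proof -
  interpret to_ac: field_hom "to_ac :: 'a \<Rightarrow> 'a alg_closure" by unfold_locales auto
  interpret map_poly_comm_ring_hom "to_ac :: 'a \<Rightarrow> 'a alg_closure" by unfold_locales
  let ?r = "char_poly M"
  have monic: "monic ?r" using degree_monic_char_poly[OF M] by simp
  then have "?r \<noteq> 0" by auto
  obtain s where s: "?r = [:- a, 1:] ^ order a ?r * s" "\<not> [:- a, 1:] dvd s"
    using order_decomp[OF \<open>?r \<noteq> 0\<close>] by blast
  then have "s \<noteq> 0" by auto
  obtain t where t: "s = [:- b, 1:] ^ order b s * t" "\<not> [:- b, 1:] dvd t"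
    using order_decomp[OF \<open>s \<noteq> 0\<close>] by blast
  have r: "?r = [:- a, 1:] ^ order a ?r * [:- b, 1:] ^ order b s * t"
    using s(1) t(1) by (metis mult.assoc)
  have "degree (map_poly to_ac t) = 0"
  proof (rule ccontr)
    assume "degree (map_poly to_ac t) \<noteq> 0"
    then obtain \<mu> where \<mu>: "poly (map_poly to_ac t) \<mu> = 0"
      using alg_closed_imp_poly_has_root[of "map_poly to_ac t"] by auto
    have "map_poly to_ac ?r = map_poly to_ac ([:- a, 1:] ^ order a ?r * [:- b, 1:] ^ order b s) * map_poly to_ac t"
      by (subst r) (rule hom_mult)
    then have "poly (map_poly to_ac ?r) \<mu> = 0" using \<mu> by simp
    then have "eigenvalue (map_mat to_ac M) \<mu>"
      using eigenvalue_root_char_poly[of "map_mat to_ac M" n] M to_ac.char_poly_hom[OF M] by simp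
    then consider "\<mu> = to_ac a" | "\<mu> = to_ac b" using ev by auto
    then have "poly t a = 0 \<or> poly t b = 0" using \<mu> by cases simp_all
    then show False using t s(2) by (metis dvd_mult poly_eq_0_iff_dvd)
  qed
  then obtain c where c: "t = [:c:]" by (auto elim: degree_eq_zeroE)
  have "lead_coeff ?r = lead_coeff ([:- a, 1:] ^ order a ?r * [:- b, 1:] ^ order b s * t)"
    using r by (rule arg_cong)
  also have "\<dots> = lead_coeff t"
    by (simp add: lead_coeff_mult lead_coeff_power)
  finally have "lead_coeff ?r = lead_coeff t" .
  then have "t = 1" using monic c by (simp add: one_pCons)
  then show thesis using r that by simp
qed

section \<open>The symplectic extension\<close>

lemma degree_prod_mset_linear: "degree (\<Prod>a\<in>#A. [:- a, 1:]) = size (A :: 'a::field multiset)"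
proof (induction A)
  case (add a A)
  have "(\<Prod>a\<in>#A. [:- a, 1:]) \<noteq> 0" by auto
  then show ?case using add by (simp add: degree_mult_eq del: mult_pCons_left)
qed simp

lemma split_simple_roots_quadratic:
  assumes "monic p" "degree p = 2" "split_simple_roots p"
  obtains a b where "a \<noteq> b" "p = [:a * b, - (a + b), 1:]"
proof -
  obtain A where A: "p = (\<Prod>a\<in>#A. [:- a, 1:])"
    using assms by (auto simp: split_simple_roots_def split_poly_def)
  then have "size A = Suc (Suc 0)" using assms(2) degree_prod_mset_linear[of A] by simp
  then obtain a B where "A = add_mset a B" "size B = 1"
    using size_eq_Suc_imp_eq_union[of A] by auto
  then obtain b where "A = {#a, b#}" using size_1_singleton_mset[of B] by auto
  with A have p: "p = [:- a, 1:] * [:- b, 1:]" by simp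
  have "a \<noteq> b"
  proof
    assume "a = b"
    then have "p = [:- a, 1:] ^ 2" using p by (simp add: power2_eq_square)
    then have "order a p = 2" "poly p a = 0" by (simp_all only: order_power_n_n) simp
    then show False using assms(3) by (auto simp: split_simple_roots_def)
  qed
  then show thesis
    by (rule that) (simp add: p algebra_simps)
qed

text \<open>The result is the normal form found for p with both roots equal to c, so
  \<open>Root_quadratic\<close> applies to p and q alike.\<close>

lemma split_double_root_quadratic:
  assumes "monic q" "degree q = 2" "split_double_root q"
  obtains c where "q = [:c * c, - (c + c), 1:]"
proof -
  obtain c where c: "order c q = 2" using assms(3) by (auto simp: split_double_root_def)
  have "q \<noteq> 0" using assms(1) by auto
  from order_decomp[OF this, of c] obtain r where r: "q = [:- c, 1:] ^ 2 * r" unfolding c by blast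
  then have "r \<noteq> 0" using \<open>q \<noteq> 0\<close> by auto
  then have "degree q = 2 + degree r" unfolding r
    by (simp add: degree_mult_eq degree_linear_power del: mult_pCons_left power2_eq_square)
  then obtain d where "r = [:d:]" using assms(2) by (auto elim: degree_eq_zeroE)
  moreover have "lead_coeff q = lead_coeff ([:- c, 1:] ^ 2 * r)" using r by (rule arg_cong)
  then have "lead_coeff r = 1" using assms(1) by (simp add: lead_coeff_mult lead_coeff_power del: mult_pCons_left)
  ultimately have "r = 1" by (simp add: one_pCons)
  with r show thesis
    by (intro that[of c]) (simp add: power2_eq_square)
qed

text \<open>The factor \<open>s 1\<close> stays because s is an arbitrary function here; the formula
  is used for \<open>ext_scale\<close> as well as for scalings of vector spaces.\<close>

lemma poly_endo_quadratic:
  "poly_endo s [:c, d, 1:] f x = s c x + s d (f x) + s 1 (f (f x))"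
  by (simp add: poly_endo_def numeral_2_eq_2 eval_nat_numeral)

lemma Root_quadratic: "Root [:a * b, - (a + b), 1:] = {to_ac a, to_ac b}"
proof -
  have "poly (map_poly to_ac [:a * b, - (a + b), 1:]) x = (x - to_ac a) * (x - to_ac b)" for x
    by (simp add: map_poly_pCons algebra_simps)
  then show ?thesis by (auto simp: Root_def)
qed

lemma endo_on_UNIV: "vector_space s \<Longrightarrow> endo_on s UNIV f \<longleftrightarrow> Vector_Spaces.linear s s f"
  by (auto simp: endo_on_def linear_on_def Vector_Spaces.linear_iff)

lemma (in finite_dimensional_vector_space) pq_difference_iff:
  "pq_difference scale UNIV [:a * b, - (a + b), 1:] [:c * c, - (c + c), 1:] u \<longleftrightarrow>
    (\<exists>D N. endo D \<and> endo N \<and> (\<forall>x. N (N x) = 0) \<and>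
      (\<forall>x. D (D x) = scale ((a - c) + (b - c)) (D x) - scale ((a - c) * (b - c)) x) \<and>
      (\<forall>x. u x = D x - N x))"
  (is "?l \<longleftrightarrow> ?r")
proof -
  have trace: "scale ((a - c) + (b - c)) y = scale a y - scale c y + (scale b y - scale c y)" for y
    by (simp only: scale_left_distrib scale_left_diff_distrib)
  have "(a - c) * (b - c) = a * b - a * c - b * c + c * c" by (simp add: algebra_simps)
  then have norm: "scale ((a - c) * (b - c)) y
      = scale (a * b) y - scale (a * c) y - scale (b * c) y + scale (c * c) y" for y
    by (simp only: scale_left_distrib scale_left_diff_distrib)
  show ?thesis
  proof
    assume ?l
    then obtain u\<^sub>1 u\<^sub>2 where u: "endo u\<^sub>1" "endo u\<^sub>2" "\<And>x. u x = u\<^sub>1 x - u\<^sub>2 x"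
      and p: "\<And>x. scale (a * b) x + scale (- (a + b)) (u\<^sub>1 x) + scale 1 (u\<^sub>1 (u\<^sub>1 x)) = 0"
      and q: "\<And>x. scale (c * c) x + scale (- (c + c)) (u\<^sub>2 x) + scale 1 (u\<^sub>2 (u\<^sub>2 x)) = 0"
      unfolding pq_difference_def poly_endo_quadratic endo_on_UNIV[OF vector_space_axioms] by auto
    have p': "u\<^sub>1 (u\<^sub>1 x) = scale a (u\<^sub>1 x) + scale b (u\<^sub>1 x) - scale (a * b) x" for x
      using p[of x] by (simp add: scale_left_distrib add_eq_0_iff algebra_simps)
    have q': "u\<^sub>2 (u\<^sub>2 x) = scale c (u\<^sub>2 x) + scale c (u\<^sub>2 x) - scale (c * c) x" for x
      using q[of x] by (simp only: scale_left_distrib scale_minus_left scale_one) (simp add: algebra_simps add_eq_0_iff)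
    show ?r
      unfolding trace norm
    proof (intro exI conjI allI)
      show "endo (\<lambda>x. u\<^sub>1 x - scale c x)" "endo (\<lambda>x. u\<^sub>2 x - scale c x)"
        by (intro endo_shift u)+
    qed (simp_all add: u p' q' endo_simps[OF u(1)] endo_simps[OF u(2)] scale_right_distrib scale_right_diff_distrib scale_left_distrib mult.commute)
  next
    assume ?r
    then obtain D N where DN: "endo D" "endo N" "\<And>x. N (N x) = 0"
      "\<And>x. D (D x) = scale ((a - c) + (b - c)) (D x) - scale ((a - c) * (b - c)) x"
      "\<And>x. u x = D x - N x" by blast
    note DD = DN(4)[unfolded trace norm]
    show ?l
      unfolding pq_difference_def poly_endo_quadratic endo_on_UNIV[OF vector_space_axioms]
        scale_minus_left scale_left_distrib scale_one
    proof (intro exI conjI ballI)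
      show "endo (\<lambda>x. D x + scale c x)" "endo (\<lambda>x. N x + scale c x)"
        using DN by (auto simp: endo_iff algebra_simps)
    qed (simp_all add: DN(3,5) DD endo_simps[OF DN(1)] endo_simps[OF DN(2)] scale_right_distrib mult.commute)
  qed
qed

text \<open>Conjugation by an isomorphism onto a carrier W. It moves differences from V times its
  dual, a proper carrier in general, to a space that fills its type. The inverse \<Theta> is
  meaningful on W only, so identities are checked after applying \<Psi> and then cancelled by
  injectivity.\<close>

lemma pq_difference_transport:
  fixes s :: "'a::field \<Rightarrow> 'v::ab_group_add \<Rightarrow> 'v" and s' :: "'a \<Rightarrow> 'w::ab_group_add \<Rightarrow> 'w"
  assumes lin: "linear_on s s' UNIV \<Psi>" and inj: "inj \<Psi>" and range: "range \<Psi> = W"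
    and u: "\<And>x. u' (\<Psi> x) = \<Psi> (u x)" and diff: "pq_difference s' W p q u'"
  shows "pq_difference s UNIV p q u"
proof -
  define \<Theta> where "\<Theta> = inv_into UNIV \<Psi>"
  have \<Theta>\<Psi>: "\<Theta> (\<Psi> x) = x" for x by (simp add: \<Theta>_def inj)
  have \<Psi>\<Theta>: "\<Psi> (\<Theta> x) = x" if "x \<in> W" for x using that range by (auto simp: \<Theta>_def f_inv_into_f)
  have W: "\<Psi> x \<in> W" for x using range by auto
  have add: "\<Psi> (x + y) = \<Psi> x + \<Psi> y" and scale: "\<Psi> (s c x) = s' c (\<Psi> x)" for x y c
    using lin by (auto simp: linear_on_def)
  have zero: "\<Psi> 0 = 0" using add[of 0 0] by simp
  have minus: "\<Psi> (x - y) = \<Psi> x - \<Psi> y" for x y using add[of "x - y" y] by simp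
  have sum: "\<Psi> (sum g I) = (\<Sum>i\<in>I. \<Psi> (g i))" for g and I :: "nat set"
    by (induction I rule: infinite_finite_induct) (auto simp: zero add)
  obtain u\<^sub>1 u\<^sub>2 where u12: "endo_on s' W u\<^sub>1" "endo_on s' W u\<^sub>2" "\<And>x. x \<in> W \<Longrightarrow> u' x = u\<^sub>1 x - u\<^sub>2 x"
    "\<And>x. x \<in> W \<Longrightarrow> poly_endo s' p u\<^sub>1 x = 0" "\<And>x. x \<in> W \<Longrightarrow> poly_endo s' q u\<^sub>2 x = 0"
    using diff by (auto simp: pq_difference_def)
  have \<Psi>_conj: "\<Psi> (\<Theta> (f (\<Psi> x))) = f (\<Psi> x)" if "endo_on s' W f" for f x
    using that W by (intro \<Psi>\<Theta>) (auto simp: endo_on_def)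
  have endo: "endo_on s UNIV (\<lambda>x. \<Theta> (f (\<Psi> x)))" if f: "endo_on s' W f" for f
  proof -
    have "\<Psi> (\<Theta> (f (\<Psi> (x + y)))) = \<Psi> (\<Theta> (f (\<Psi> x)) + \<Theta> (f (\<Psi> y)))" for x y
    proof -
      have "\<Psi> (\<Theta> (f (\<Psi> (x + y)))) = f (\<Psi> (x + y))" by (rule \<Psi>_conj[OF f])
      also have "\<dots> = f (\<Psi> x + \<Psi> y)" by (simp only: add)
      also have "\<dots> = f (\<Psi> x) + f (\<Psi> y)" using f W by (simp add: endo_on_def linear_on_def)
      also have "\<dots> = \<Psi> (\<Theta> (f (\<Psi> x)) + \<Theta> (f (\<Psi> y)))" by (simp only: \<Psi>_conj[OF f] add)
      finally show ?thesis .
    qed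
    moreover have "\<Psi> (\<Theta> (f (\<Psi> (s c x)))) = \<Psi> (s c (\<Theta> (f (\<Psi> x))))" for c x
    proof -
      have "\<Psi> (\<Theta> (f (\<Psi> (s c x)))) = f (\<Psi> (s c x))" by (rule \<Psi>_conj[OF f])
      also have "\<dots> = f (s' c (\<Psi> x))" by (simp only: scale)
      also have "\<dots> = s' c (f (\<Psi> x))" using f W by (simp add: endo_on_def linear_on_def)
      also have "\<dots> = \<Psi> (s c (\<Theta> (f (\<Psi> x))))" by (simp only: \<Psi>_conj[OF f] scale)
      finally show ?thesis .
    qed
    ultimately show ?thesis using inj by (auto simp: endo_on_def linear_on_def inj_def)
  qed
  have poly: "poly_endo s r (\<lambda>x. \<Theta> (f (\<Psi> x))) x = 0"
    if f: "endo_on s' W f" and 0: "\<And>x. x \<in> W \<Longrightarrow> poly_endo s' r f x = 0" for r f x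
  proof -
    have "\<Psi> (((\<lambda>x. \<Theta> (f (\<Psi> x))) ^^ i) x) = (f ^^ i) (\<Psi> x)" for i
    proof (induction i)
      case (Suc i)
      have "\<Psi> (((\<lambda>x. \<Theta> (f (\<Psi> x))) ^^ Suc i) x) = f (\<Psi> (((\<lambda>x. \<Theta> (f (\<Psi> x))) ^^ i) x))"
        unfolding funpow.simps o_apply by (rule \<Psi>_conj[OF f])
      also have "\<dots> = (f ^^ Suc i) (\<Psi> x)" by (simp add: Suc.IH)
      finally show ?case .
    qed simp
    then have "\<Psi> (poly_endo s r (\<lambda>x. \<Theta> (f (\<Psi> x))) x) = poly_endo s' r f (\<Psi> x)"
      by (simp add: poly_endo_def sum scale)
    then show ?thesis using 0[OF W] zero inj by (metis inj_def)
  qed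
  have "\<Psi> (u x) = \<Psi> (\<Theta> (u\<^sub>1 (\<Psi> x)) - \<Theta> (u\<^sub>2 (\<Psi> x)))" for x
    using u12(3)[OF W, of x] by (simp add: u minus \<Psi>_conj u12)
  then have "u x = \<Theta> (u\<^sub>1 (\<Psi> x)) - \<Theta> (u\<^sub>2 (\<Psi> x))" for x using inj by (auto simp: inj_def)
  then show ?thesis
    unfolding pq_difference_def using endo u12 poly by blast
qed

section \<open>Adjoints with respect to a coordinate form\<close>

context finite_dimensional_vector_space
begin

text \<open>The dot product in the coordinates of \<open>Basis\<close>. Isotropic vectors may exist,
  but sending x to \<open>coord_form x\<close> is an isomorphism of V onto its dual.\<close>

definition coord_form :: "'b \<Rightarrow> 'b \<Rightarrow> 'a" where
  "coord_form x y = (\<Sum>e\<in>Basis. representation Basis x e * representation Basis y e)"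

lemma coord_form_commute: "coord_form x y = coord_form y x"
  by (simp add: coord_form_def mult.commute)

lemma coord_form_add: "coord_form (x + y) t = coord_form x t + coord_form y t"
  and coord_form_scale: "coord_form (scale c x) t = c * coord_form x t"
  by (simp_all add: coord_form_def representation_add[OF independent_Basis] span_Basis
      representation_scale[OF independent_Basis] distrib_right sum.distrib sum_distrib_left mult.assoc)

lemma coord_form_add_right: "coord_form t (x + y) = coord_form t x + coord_form t y"
  and coord_form_scale_right: "coord_form t (scale c x) = c * coord_form t x"
  using coord_form_add[of x y t] coord_form_scale[of c x t] by (simp_all add: coord_form_commute)

lemma coord_form_sum: "coord_form (sum g I) t = (\<Sum>i\<in>I. coord_form (g i) t)"
proof -
  have "coord_form 0 t = 0" using coord_form_scale[of 0 0 t] by simp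
  then show ?thesis by (induction I rule: infinite_finite_induct) (simp_all add: coord_form_add)
qed

lemma coord_form_Basis: "e \<in> Basis \<Longrightarrow> coord_form x e = representation Basis x e"
  by (simp add: coord_form_def representation_basis[OF independent_Basis] finite_Basis if_distrib sum.delta cong: if_cong)

lemma sum_representation_Basis: "(\<Sum>e\<in>Basis. scale (representation Basis x e) e) = x"
  by (intro sum_representation_eq independent_Basis finite_Basis) (auto simp: span_Basis)

lemma coord_form_eqI: "(\<And>t. coord_form x t = coord_form y t) \<Longrightarrow> x = y"
  by (metis (no_types, lifting) coord_form_Basis sum.cong sum_representation_Basis)

lemma coord_form_surj:
  assumes "\<phi> \<in> dual_space scale"
  shows "coord_form (\<Sum>e\<in>Basis. scale (\<phi> e) e) = \<phi>"
proof
  fix t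
  interpret \<phi>: Vector_Spaces.linear scale "(*)" \<phi> using assms by (simp add: dual_space_def)
  have "coord_form (\<Sum>e\<in>Basis. scale (\<phi> e) e) t = (\<Sum>e\<in>Basis. representation Basis t e * \<phi> e)"
    unfolding coord_form_sum
    by (intro sum.cong) (simp_all add: coord_form_commute[of _ t] coord_form_scale_right coord_form_Basis mult.commute)
  also have "\<dots> = \<phi> (\<Sum>e\<in>Basis. scale (representation Basis t e) e)"
    by (simp add: \<phi>.sum \<phi>.scale)
  finally show "coord_form (\<Sum>e\<in>Basis. scale (\<phi> e) e) t = \<phi> t" by (simp add: sum_representation_Basis)
qed

lemma coord_form_dual: "coord_form x \<in> dual_space scale"
  unfolding dual_space_def Vector_Spaces.linear_iff
  by (auto simp: coord_form_add_right coord_form_scale_right vector_space_axioms)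
    (unfold_locales, auto simp: algebra_simps)

text \<open>Ker g is the orthogonal of the range of f. L bundles the dim (range f) equations that
  define it into one endomorphism with values in that range; rank-nullity for L and for f then
  compares the kernels.\<close>

lemma dim_ker_adjoint_le:
  assumes f: "endo f" and g: "endo g" and adj: "\<And>x y. coord_form (g x) y = coord_form x (f y)"
  shows "dim (ker f) \<le> dim (ker g)"
proof -
  let ?S = "range f"
  obtain C where C: "C \<subseteq> ?S" "independent C" "?S \<subseteq> span C" using basis_exists by metis
  have fin: "finite C" using C finiteI_independent by auto
  define L where "L x = (\<Sum>c\<in>C. scale (coord_form x c) c)" for x
  have L: "endo L"
    by (rule endoI) (simp_all add: L_def coord_form_add coord_form_scale scale_left_distrib sum.distrib scale_sum_right)
  have "ker L \<subseteq> ker g"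
  proof clarify
    fix x assume "L x = 0"
    then have 0: "\<forall>c\<in>C. coord_form x c = 0"
      using C(2) fin by (auto simp: L_def independent_explicit)
    interpret \<phi>: Vector_Spaces.linear scale "(*)" "coord_form x"
      using coord_form_dual[of x] by (simp add: dual_space_def)
    have "coord_form x y = 0" if "y \<in> span C" for y
      using \<phi>.eq_0_on_span[of C y] 0 that by blast
    then have "coord_form (g x) y = coord_form 0 y" for y
      using C(3) adj[of x y] coord_form_scale[of 0 0 y] by auto
    then show "g x = 0" by (rule coord_form_eqI)
  qed
  then have "dim (ker L) \<le> dim (ker g)" by (rule dim_subset)
  moreover have "L ` UNIV \<subseteq> ?S"
    using subspace_image_endo[OF f subspace_UNIV] C(1)
    by (auto simp: L_def intro!: subspace_sum subspace_scale)
  then have "dim (L ` UNIV) \<le> dim ?S" by (rule dim_subset)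
  ultimately show ?thesis
    using rank_nullity_on[OF L subspace_UNIV] rank_nullity_on[OF f subspace_UNIV] by simp
qed

lemma dim_ker_adjoint:
  assumes f: "endo f" and g: "endo g" and adj: "\<And>x y. coord_form (g x) y = coord_form x (f y)"
  shows "dim (ker g) = dim (ker f)"
proof (rule order_antisym)
  have "coord_form (f x) y = coord_form x (g y)" for x y
  proof -
    have "coord_form (f x) y = coord_form y (f x)" by (rule coord_form_commute)
    also have "\<dots> = coord_form (g y) x" by (rule adj[symmetric])
    also have "\<dots> = coord_form x (g y)" by (rule coord_form_commute)
    finally show ?thesis .
  qed
  then show "dim (ker g) \<le> dim (ker f)" by (rule dim_ker_adjoint_le[OF g f])
  show "dim (ker f) \<le> dim (ker g)" by (rule dim_ker_adjoint_le[OF f g adj])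
qed

lemma ex_adjoint:
  assumes v: "endo v"
  obtains v' where "endo v'" "\<And>x y. coord_form (v' x) y = coord_form x (v y)"
proof
  define v' where "v' x = (\<Sum>e\<in>Basis. scale (coord_form x (v e)) e)" for x
  show "coord_form (v' x) y = coord_form x (v y)" for x y
  proof -
    have "(\<lambda>y. coord_form x (v y)) \<in> dual_space scale"
      using coord_form_dual[of x] unfolding dual_space_def mem_Collect_eq Vector_Spaces.linear_iff
      by (simp add: endo_simps[OF v])
    from coord_form_surj[OF this] show ?thesis by (simp add: v'_def fun_eq_iff)
  qed
  show "endo v'"
    by (rule endoI) (simp_all add: v'_def coord_form_add coord_form_scale scale_left_distrib sum.distrib scale_sum_right)
qed

lemma jordan_count_adjoint_sum:
  assumes v: "endo v" and v': "endo v'" and adj: "\<And>x y. coord_form (v' x) y = coord_form x (v y)"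
  shows "jordan_count (module_prod.scale scale scale) (map_prod v v') \<mu> k = 2 * jordan_count scale v \<mu> k"
proof -
  interpret prod: finite_dimensional_vector_space_prod scale scale Basis Basis by unfold_locales
  let ?w = "\<lambda>y. v y - scale \<mu> y" and ?w' = "\<lambda>y. v' y - scale \<mu> y"
  have w: "endo ?w" "endo ?w'" by (intro endo_shift v v')+
  have form_diff: "coord_form (x - y) t = coord_form x t - coord_form y t"
    "coord_form t (x - y) = coord_form t x - coord_form t y" for x y t
    using coord_form_add[of "x - y" y t] coord_form_add_right[of t "x - y" y] by simp_all
  have adj_w: "coord_form (?w' x) y = coord_form x (?w y)" for x y
    by (simp add: form_diff adj coord_form_scale coord_form_scale_right)
  have adj_k: "coord_form ((?w' ^^ k) x) y = coord_form x ((?w ^^ k) y)" for x y k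
  proof (induction k arbitrary: y)
    case (Suc k)
    have "coord_form ((?w' ^^ Suc k) x) y = coord_form ((?w' ^^ k) x) (?w y)"
      unfolding funpow.simps o_apply by (rule adj_w)
    also have "\<dots> = coord_form x ((?w ^^ Suc k) y)"
      unfolding Suc.IH funpow_Suc_right o_apply ..
    finally show ?case .
  qed simp
  have dim_eq: "dim (ker_pow scale v' \<mu> k) = dim (ker_pow scale v \<mu> k)" for k
    unfolding ker_pow_def by (rule dim_ker_adjoint[OF endo_pow[OF w(1)] endo_pow[OF w(2)] adj_k])
  have "((\<lambda>y. map_prod v v' y - module_prod.scale scale scale \<mu> y) ^^ k) z = ((?w ^^ k) (fst z), (?w' ^^ k) (snd z))" for z k
    by (induction k) (auto simp: prod.scale_def)
  then have ker: "ker_pow (module_prod.scale scale scale) (map_prod v v') \<mu> k = ker_pow scale v \<mu> k \<times> ker_pow scale v' \<mu> k" for k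
    by (auto simp: ker_pow_def zero_prod_def)
  have sub: "subspace (ker_pow scale v \<mu> k)" "subspace (ker_pow scale v' \<mu> k)" for k
    unfolding ker_pow_def by (intro subspace_ker endo_pow w)+
  have "prod.p.dim (ker_pow (module_prod.scale scale scale) (map_prod v v') \<mu> k) = 2 * dim (ker_pow scale v \<mu> k)" for k
    unfolding ker prod.dim_Times[OF sub] dim_eq by simp
  then show ?thesis unfolding jordan_count_def by simp
qed

text \<open>The isomorphism is the identity times \<open>coord_form\<close>: the transpose of v
  sends \<open>coord_form x\<close> to \<open>coord_form (v' x)\<close>, so it carries the direct
  sum of v and v' to h(v).\<close>

lemma pq_difference_h_ext:
  assumes v: "endo v" and v': "endo v'" and adj: "\<And>x y. coord_form (v' x) y = coord_form x (v y)"
    and diff: "pq_difference (ext_scale scale) (ext_space scale) p q (h_ext v)"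
  shows "pq_difference (module_prod.scale scale scale) UNIV p q (map_prod v v')"
proof (rule pq_difference_transport[OF _ _ _ _ diff])
  interpret prod: vector_space_prod scale scale by unfold_locales
  let ?\<Psi> = "map_prod id coord_form"
  show "linear_on prod.scale (ext_scale scale) UNIV ?\<Psi>"
    by (auto simp: linear_on_def prod.scale_def ext_scale_def coord_form_add coord_form_scale)
  show "inj ?\<Psi>"
    using coord_form_eqI by (auto simp: inj_def)
  show "range ?\<Psi> = ext_space scale"
  proof (intro equalityI subsetI)
    fix z assume "z \<in> ext_space scale"
    then obtain x \<phi> where z: "z = (x, \<phi>)" "\<phi> \<in> dual_space scale" by (auto simp: ext_space_def)
    then have "z = ?\<Psi> (x, \<Sum>e\<in>Basis. scale (\<phi> e) e)" by (simp add: coord_form_surj)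
    then show "z \<in> range ?\<Psi>" by (rule range_eqI)
  qed (auto simp: ext_space_def coord_form_dual)
  show "h_ext v (?\<Psi> x) = ?\<Psi> (map_prod v v' x)" for x
    by (cases x) (simp add: h_ext_def transpose_endo_def fun_eq_iff adj)
qed

lemma pq_difference_imp_intertwined:
  assumes "pq_difference scale UNIV [:a * b, - (a + b), 1:] [:c * c, - (c + c), 1:] u" "a \<noteq> b"
  shows "intertwined 2 (jordan_count scale u (a - c)) (jordan_count scale u (b - c))"
proof -
  obtain D N where DN: "endo D" "endo N" "\<And>x. N (N x) = 0"
    "\<And>x. D (D x) = scale ((a - c) + (b - c)) (D x) - scale ((a - c) * (b - c)) x"
    "\<And>x. u x = D x - N x"
    using assms(1) unfolding pq_difference_iff by blast
  then have u: "u = (\<lambda>x. D x - N x)" by (intro ext)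
  interpret quadratic_difference scale Basis D N "a - c" "b - c"
    by (intro quadratic_difference.intro quadratic_difference_axioms.intro finite_dimensional_vector_space_axioms DN)
      (use assms(2) in simp)
  show ?thesis unfolding u by (rule intertwined_jordan_count)
qed

text \<open>Necessity is applied on V times V to the direct sum of v and an adjoint. Its counts are
  doubled on both sides of each inequality, so the factor 2 cancels.\<close>

lemma h_ext_pq_difference_imp_intertwined:
  assumes v: "endo v" and "a \<noteq> b"
    and "pq_difference (ext_scale scale) (ext_space scale) [:a * b, - (a + b), 1:] [:c * c, - (c + c), 1:] (h_ext v)"
  shows "intertwined 2 (jordan_count scale v (a - c)) (jordan_count scale v (b - c))"
proof -
  interpret prod: finite_dimensional_vector_space_prod scale scale Basis Basis by unfold_locales
  obtain v' where v': "endo v'" "\<And>x y. coord_form (v' x) y = coord_form x (v y)"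
    using ex_adjoint[OF v] by blast
  show ?thesis
    using prod.p.pq_difference_imp_intertwined[OF pq_difference_h_ext[OF v v' assms(3)] assms(2)]
    unfolding jordan_count_adjoint_sum[OF v v'] intertwined_def by simp
qed

text \<open>Cayley-Hamilton, with the characteristic polynomial factored over the base field as (t -
  a)^i (t - b)^j; i + j serves as the common exponent.\<close>

lemma pq_exceptional_imp_two_eigenvalues:
  assumes v: "endo v" and exc: "pq_exceptional scale p q v"
    and Rd: "Root_diff p q = {to_ac a, to_ac b}" and ab: "a \<noteq> b"
  shows "\<exists>n. two_eigenvalues scale Basis v a b n"
proof -
  obtain bs where bs: "set bs = Basis" "distinct bs" using finite_distinct_list[OF finite_Basis] by blast
  then have ob: "ordered_basis scale bs"
    by (simp add: ordered_basis_def independent_Basis span_Basis)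
  have M: "endo_mat scale bs v \<in> carrier_mat (length bs) (length bs)" by (simp add: endo_mat_def)
  have "\<mu> \<in> {to_ac a, to_ac b}" if "eigenvalue (map_mat to_ac (endo_mat scale bs v)) \<mu>" for \<mu>
    using that exc ob Rd by (auto simp: pq_exceptional_def ac_eigenvalue_def)
  then obtain i j where ij: "char_poly (endo_mat scale bs v) = [:- a, 1:] ^ i * [:- b, 1:] ^ j"
    using char_poly_eq_linear_powers[OF M ab] by blast
  let ?wa = "\<lambda>y. v y - scale a y" and ?wb = "\<lambda>y. v y - scale b y"
  have w: "endo ?wa" "endo ?wb" by (intro endo_shift v)+
  have zero: "(?wa ^^ i) ((?wb ^^ j) x) = 0" for x
    using poly_endo_char_poly[OF v ob, of x] unfolding ij poly_endo_mult[OF v] poly_endo_linear_power[OF v] .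
  have "(?wa ^^ (i + j)) ((?wb ^^ (i + j)) x) = 0" for x
  proof -
    have "(?wa ^^ (i + j)) ((?wb ^^ (i + j)) x) = (?wa ^^ (j + i)) ((?wb ^^ (j + i)) x)"
      by (simp only: add.commute)
    also have "\<dots> = (?wa ^^ j) ((?wa ^^ i) ((?wb ^^ j) ((?wb ^^ i) x)))"
      by (simp only: funpow_add o_apply)
    finally show ?thesis unfolding zero by (simp only: endo_zero[OF endo_pow[OF w(1)]])
  qed
  then show ?thesis
    by (intro exI[of _ "i + j"] two_eigenvalues.intro two_eigenvalues_axioms.intro
        finite_dimensional_vector_space_axioms v ab)
qed

section \<open>Symplectic differences from differences in End(V)\<close>

lemma symplectic_form_S: "symplectic_form (ext_scale scale) (ext_space scale) S_form"
proof -
  have lin: "\<phi> (x + y) = \<phi> x + \<phi> y" "\<phi> (scale c x) = c * \<phi> x" "\<phi> 0 = 0"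
    if "\<phi> \<in> dual_space scale" for \<phi> x y c
  proof -
    interpret \<phi>: Vector_Spaces.linear scale "(*)" \<phi> using that by (simp add: dual_space_def)
    show "\<phi> (x + y) = \<phi> x + \<phi> y" "\<phi> (scale c x) = c * \<phi> x" "\<phi> 0 = 0"
      by (fact \<phi>.add \<phi>.scale \<phi>.zero)+
  qed
  \<comment> \<open>Pairing with (y, 0) recovers the functional, and pairing with the functionals
    \<open>coord_form t\<close>, which separate points, recovers the vector.\<close>
  have nondeg: "x = 0" if orth: "\<forall>y\<in>ext_space scale. S_form x y = 0" and mem: "x \<in> ext_space scale" for x
  proof -
    obtain s \<phi> where x: "x = (s, \<phi>)" "\<phi> \<in> dual_space scale" using mem by (auto simp: ext_space_def)
    have "coord_form 0 = (\<lambda>_. 0)" using coord_form_scale[of 0 0] by (intro ext) simp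
    then have 0: "(\<lambda>_. 0) \<in> dual_space scale" using coord_form_dual[of 0] by simp
    have "\<phi> y = 0" for y
      using orth 0 x by (auto simp: ext_space_def S_form_def)
    moreover have "coord_form s t = coord_form 0 t" for t
    proof -
      have "(0, coord_form t) \<in> ext_space scale" by (simp add: ext_space_def coord_form_dual)
      then have "coord_form t s = 0" using orth x lin(3)[OF x(2)] by (force simp: S_form_def)
      then show ?thesis using coord_form_scale[of 0 0 t] coord_form_commute[of s t] by simp
    qed
    then have "s = 0" by (rule coord_form_eqI)
    ultimately show ?thesis using x by (simp add: zero_prod_def fun_eq_iff)
  qed
  then show ?thesis
    unfolding symplectic_form_def linear_on_def
    by (auto simp: ext_space_def S_form_def ext_scale_def lin algebra_simps)
qed

text \<open>Evaluating \<open>S_form\<close> at (x, \<phi>) and its image gives \<phi> (f x) -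
  \<phi> (f x), which is 0 in every characteristic.\<close>

lemma alternating_h_ext:
  assumes f: "endo f"
  shows "alternating_endo (ext_scale scale) (ext_space scale) S_form (h_ext f)"
proof -
  have "\<phi> \<circ> f \<in> dual_space scale" if "\<phi> \<in> dual_space scale" for \<phi>
    using that unfolding dual_space_def mem_Collect_eq Vector_Spaces.linear_iff by (simp add: endo_simps[OF f])
  then show ?thesis
    by (auto simp: alternating_endo_def endo_on_def linear_on_def ext_space_def h_ext_def transpose_endo_def
        ext_scale_def S_form_def endo_simps[OF f] fun_eq_iff)
qed

lemma poly_endo_h_ext:
  assumes "\<And>x. poly_endo scale [:c, d, 1:] f x = 0" "w \<in> ext_space scale"
  shows "poly_endo (ext_scale scale) [:c, d, 1:] (h_ext f) w = 0"
proof -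
  obtain x \<phi> where w: "w = (x, \<phi>)" "\<phi> \<in> dual_space scale" using assms(2) by (auto simp: ext_space_def)
  interpret \<phi>: Vector_Spaces.linear scale "(*)" \<phi> using w(2) by (simp add: dual_space_def)
  have "c * \<phi> y + d * \<phi> (f y) + \<phi> (f (f y)) = \<phi> (scale c y + scale d (f y) + scale 1 (f (f y)))" for y
    by (simp add: \<phi>.add \<phi>.scale)
  then have "c * \<phi> y + d * \<phi> (f y) + \<phi> (f (f y)) = 0" for y
    using assms(1)[of y] by (simp add: poly_endo_quadratic \<phi>.zero)
  then show ?thesis
    using assms(1)[of x] w
    by (simp add: poly_endo_quadratic h_ext_def transpose_endo_def ext_scale_def zero_prod_def fun_eq_iff)
qed

text \<open>h turns differences of endomorphisms into differences, preserves the quadratic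
  relations, and takes only alternating values.\<close>

lemma pq_difference_imp_symplectic:
  assumes v: "endo v" and diff: "pq_difference scale UNIV [:a, b, 1:] [:c, d, 1:] v"
  shows "symplectic_pq_difference (ext_scale scale) (ext_space scale) [:a, b, 1:] [:c, d, 1:] (S_ext v)"
proof -
  obtain v\<^sub>1 v\<^sub>2 where v12: "endo v\<^sub>1" "endo v\<^sub>2" "\<And>x. v x = v\<^sub>1 x - v\<^sub>2 x"
    "\<And>x. poly_endo scale [:a, b, 1:] v\<^sub>1 x = 0" "\<And>x. poly_endo scale [:c, d, 1:] v\<^sub>2 x = 0"
    using diff unfolding pq_difference_def endo_on_UNIV[OF vector_space_axioms] by blast
  have "h_ext v w = h_ext v\<^sub>1 w - h_ext v\<^sub>2 w" if mem: "w \<in> ext_space scale" for w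
  proof -
    obtain x \<phi> where w: "w = (x, \<phi>)" "\<phi> \<in> dual_space scale" using mem by (auto simp: ext_space_def)
    interpret \<phi>: Vector_Spaces.linear scale "(*)" \<phi> using w(2) by (simp add: dual_space_def)
    show ?thesis by (simp add: w h_ext_def transpose_endo_def v12(3) fun_eq_iff \<phi>.diff)
  qed
  then show ?thesis
    unfolding symplectic_pq_difference_def symplectic_pair_def S_ext_def prod.case
    using symplectic_form_S alternating_h_ext[OF v] alternating_h_ext[OF v12(1)] alternating_h_ext[OF v12(2)]
      poly_endo_h_ext[OF v12(4)] poly_endo_h_ext[OF v12(5)] by blast
qed

end

text \<open>The existence clause keeps the quantified equivalences from being vacuous; the
  quantifier covers both ways to name the two elements.\<close>

theorem theorem4p6:
  fixes scale :: "'a::field \<Rightarrow> 'v::ab_group_add \<Rightarrow> 'v"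
    and Basis :: "'v set"
    and p q :: "'a poly" and \<delta> :: 'a
    and v :: "'v \<Rightarrow> 'v"
  assumes V: "finite_dimensional_vector_space scale Basis"
    and p: "monic p" "degree p = 2" "split_simple_roots p"
    and q: "monic q" "degree q = 2" "split_double_root q"
    and \<delta>: "\<delta> = poly_tr p - poly_tr q"
    and v: "Vector_Spaces.linear scale scale v" "pq_exceptional scale p q v"
  shows "(\<exists>x. Root_diff p q = {to_ac x, to_ac (\<delta> - x)}) \<and>
    (\<forall>x. Root_diff p q = {to_ac x, to_ac (\<delta> - x)} \<longrightarrow>
      (symplectic_pq_difference (ext_scale scale) (ext_space scale) p q (S_ext v) \<longleftrightarrow>
         pq_difference (ext_scale scale) (ext_space scale) p q (h_ext v)) \<and>
      (pq_difference (ext_scale scale) (ext_space scale) p q (h_ext v) \<longleftrightarrow>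
         pq_difference scale UNIV p q v) \<and>
      (pq_difference scale UNIV p q v \<longleftrightarrow>
         intertwined 2 (jordan_count scale v x) (jordan_count scale v (\<delta> - x))))"
proof -
  interpret V: finite_dimensional_vector_space scale Basis by (fact V)
  obtain a b where ab: "a \<noteq> b" and p_eq: "p = [:a * b, - (a + b), 1:]"
    using split_simple_roots_quadratic[OF p] .
  obtain c where q_eq: "q = [:c * c, - (c + c), 1:]"
    using split_double_root_quadratic[OF q] .
  have ab': "a - c \<noteq> b - c" using ab by simp
  have \<delta>': "\<delta> = (a - c) + (b - c)"
    unfolding \<delta> poly_tr_def p_eq q_eq by simp
  have Rd: "Root_diff p q = {to_ac (a - c), to_ac (b - c)}"
    unfolding Root_diff_def p_eq q_eq Root_quadratic by auto
  let ?i = "symplectic_pq_difference (ext_scale scale) (ext_space scale) p q (S_ext v)"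
  let ?ii = "pq_difference (ext_scale scale) (ext_space scale) p q (h_ext v)"
  let ?iii = "pq_difference scale UNIV p q v"
  let ?iv = "\<lambda>x y. intertwined 2 (jordan_count scale v x) (jordan_count scale v y)"
  \<comment> \<open>The implications close into the cycle (iii), (i), (ii), (iv), (iii);
    exceptionality enters only in the last one.\<close>
  have 31: "?iii \<Longrightarrow> ?i"
    unfolding p_eq q_eq by (rule V.pq_difference_imp_symplectic[OF v(1)])
  have 12: "?i \<Longrightarrow> ?ii"
    unfolding symplectic_pq_difference_def symplectic_pair_def S_ext_def pq_difference_def alternating_endo_def
    by auto
  have 24: "?ii \<Longrightarrow> ?iv (a - c) (b - c)"
    unfolding p_eq q_eq by (rule V.h_ext_pq_difference_imp_intertwined[OF v(1) ab])
  have 43: "?iii" if "?iv (a - c) (b - c)"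
  proof -
    obtain n where "two_eigenvalues scale Basis v (a - c) (b - c) n"
      using V.pq_exceptional_imp_two_eigenvalues[OF v Rd ab'] by blast
    from two_eigenvalues.difference_if_intertwined[OF this that] show ?thesis
      unfolding p_eq q_eq V.pq_difference_iff by blast
  qed
  \<comment> \<open>\<open>Root_diff p q\<close> determines x only up to exchange with \<delta> - x,
    and being intertwined is symmetric in the two sequences.\<close>
  have iv: "?iv x (\<delta> - x) \<longleftrightarrow> ?iv (a - c) (b - c)" if "Root_diff p q = {to_ac x, to_ac (\<delta> - x)}" for x
  proof -
    have "to_ac x \<in> {to_ac (a - c), to_ac (b - c)}" using that Rd by blast
    then have "x = a - c \<or> x = b - c"
      by (simp only: insert_iff empty_iff to_ac_eq_iff simp_thms)
    then show ?thesis
      by (auto simp: \<delta>' intertwined_def)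
  qed
  have "Root_diff p q = {to_ac (a - c), to_ac (\<delta> - (a - c))}"
    unfolding Rd \<delta>' by simp
  then show ?thesis using 31 12 24 43 iv by blast
qed

end
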